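(* Let $\Omega,\tau,A,f,L$ satisfy the assumptions listed in the context. Let $\bar u\in L^2(\Omega)$ be a local solution, in the $L^2(\Omega)$-sense, of the problem of minimizing $J(u)=\int_\Omega L(x,y_u(x),u(x))\,dx$ over all $u\in L^2(\Omega)$ with $\|u\|_0\le\tau$, with associated state $\bar y:=y_{\bar u}\in W^{1,p}_0(\Omega)$, where $p>d$ is such that $W^{1,p'}_0(\Omega)\hookrightarrow L^2(\Omega)$, $\frac1p+\frac1{p'}=1$. Let $\bar\phi\in W^{1,p'}_0(\Omega)$ be the associated adjoint state, i.e. $\bar\phi$ solves $A^*\bar\phi=f_y(\cdot,\bar y,\bar u)\bar\phi+L_y(\cdot,\bar y,\bar u)$ and satisfies $$\int_\Omega H(x,\bar y(x),\bar u(x),\bar\phi(x))\,dx\le\int_\Omega H(x,\bar y(x),v(x),\bar\phi(x))\,dx\quad\text{for all } v\in L^2(\Omega)\text{ with }\|v\|_0\le\tau.$$ Then there is a number $s\le0$ such that $$s(\|\bar u\|_0-\tau)=0$$ and for almost all $x\in\Omega$ the number $\bar u(x)$ is a minimizer over $u\in\mathbb R$ of $$u\mapsto H(x,\bar y(x),u,\bar\phi(x))+(-s)|u|_0 .$$ In addition, the following hold for almost all $x\in\Omega$: if $\bar u(x)\ne0$, then $\bar u(x)$ is a minimizer over $u\in\mathbb R$ of $u\mapsto H(x,\bar y(x),u,\bar\phi(x))$; and $$|\bar u(x)|_0\cdot\Big(\inf_{u\in\mathbb R}H(x,\bar y(x),u,\bar\phi(x))-H(x,\bar y(x),0,\ba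r\phi(x))-s\Big)\le0.$$
   Context: For $u\in\mathbb R$, $|u|_0:=1$ if $u\ne0$ and $|0|_0:=0$. For measurable $u:\Omega\to\mathbb R$, $\|u\|_0:=\operatorname{meas}\{x\in\Omega: u(x)\neq0\}=\int_\Omega|u(x)|_0\,dx$ (Lebesgue measure). Assumptions: (1) $\Omega\subset\mathbb R^d$, $d\in\{2,3\}$, is an open bounded domain with Lipschitz boundary, and $\tau\in(0,\operatorname{meas}(\Omega))$. (2) $Ay=-\sum_{i,j=1}^d\partial_{x_j}(a_{ij}(x)\partial_{x_i}y)$ with $a_{ij}\in C(\bar\Omega)$, and there is $\Lambda>0$ such that for almost all $x\in\Omega$: $\sum_{i,j}a_{ij}(x)\xi_i\xi_j\ge\Lambda|\xi|^2$ for all $\xi\in\mathbb R^d$. (3) $f,L:\Omega\times\mathbb R\times\mathbb R\to\mathbb R$ are Carathéodory functions: $x\mapsto f(x,y,u)$, $x\mapsto L(x,y,u)$ are measurable for all $y,u\in\mathbb R$, and $(y,u)\mapsto f(x,y,u)$, $(y,u)\mapsto L(x,y,u)$ are continuous for almost all $x$. They are continuously differentiable with respect to $y$ for almost all $x\in\Omega$ and all $u\in\mathbb R$ (partial derivatives $f_y,L_y$), with $f_y(x,y,u)\le0$. For every $M>0$ there are non-negative $a_M\in L^1(\Omega)$, $b_M\in\mathbb R$, $c_M\in L^2(\Omega)$ such that for almost all $x\in\Omega$, all $u\in\mathbb R$ and all $|y|\le M$: $|L(x,y,u)|+|L_y(x,y,u)|\le a_M(x)+b_M|u|^2$ and $|f(x,y,u)|+|f_y(x,y,u)|\le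 c_M(x)+b_M|u|$. State: under these assumptions, for each $u\in L^2(\Omega)$ there is a unique weak solution $y_u\in W^{1,p}_0(\Omega)$ (for some $p>d$) of $(Ay)(x)=f(x,y(x),u(x))$ in $\Omega$, $y=0$ on $\partial\Omega$. Local solution in the $L^2(\Omega)$-sense: $\bar u\in L^2(\Omega)$, $\|\bar u\|_0\le\tau$, and there is $r>0$ such that $J(\bar u)\le J(u)$ for all $u\in L^2(\Omega)$ with $\|u\|_0\le\tau$ and $\|u-\bar u\|_{L^2(\Omega)}<r$. $A^*$ is the formal adjoint of $A$; the adjoint equation is understood in the weak sense: $\int_\Omega\sum_{i,j}a_{ij}\,\partial_{x_i}z\,\partial_{x_j}\bar\phi\,dx=\int_\Omega (f_y(x,\bar y,\bar u)\bar\phi+L_y(x,\bar y,\bar u))z\,dx$ for all $z\in W^{1,p}_0(\Omega)$. Hamiltonian: $H(x,y,u,\phi):=L(x,y,u)+\phi f(x,y,u)$. *)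

theory Defs
  imports "HOL-Analysis.Analysis"
begin

text \<open>
  Functions on \<Omega> are total functions on \<^typ>\<open>real^'n\<close>; only their values on \<Omega>, up to null sets,
  matter, because all integrals and almost-everywhere statements refer to
  \<^term>\<open>lebesgue_on \<Omega>\<close>.
\<close>

section \<open>Lebesgue spaces\<close>

definition Lp :: "real \<Rightarrow> (real^'n) set \<Rightarrow> (real^'n \<Rightarrow> real) set" where
  "Lp p \<Omega> = {u \<in> borel_measurable (lebesgue_on \<Omega>).
     integrable (lebesgue_on \<Omega>) (\<lambda>x. \<bar>u x\<bar> powr p)}"

definition Lp_norm :: "real \<Rightarrow> (real^'n) set \<Rightarrow> (real^'n \<Rightarrow> real) \<Rightarrow> real" where
  "Lp_norm p \<Omega> u = (\<integral>x. \<bar>u x\<bar> powr p \<partial>(lebesgue_on \<Omega>)) powr (1 / p)"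

definition abs0 :: "real \<Rightarrow> real" where
  "abs0 u = of_bool (u \<noteq> 0)"

definition norm0 :: "(real^'n) set \<Rightarrow> (real^'n \<Rightarrow> real) \<Rightarrow> real" where
  "norm0 \<Omega> u = measure lebesgue {x \<in> \<Omega>. u x \<noteq> 0}"

section \<open>Lipschitz boundary\<close>

text \<open>
  Near each boundary point, \<Omega> is the strict epigraph, in some direction \<open>e\<close>, of a Lipschitz
  function \<open>g\<close> on the hyperplane orthogonal to \<open>e\<close>; \<open>x - (x \<bullet> e) *\<^sub>R e\<close> is the projection of
  \<open>x\<close> to that hyperplane.
\<close>

definition lipschitz_boundary :: "(real^'n) set \<Rightarrow> bool" where
  "lipschitz_boundary \<Omega> \<longleftrightarrow>
     (\<forall>z \<in> frontier \<Omega>. \<exists>r>0. \<exists>e g C. norm e = 1 \<and> C-lipschitz_on {v. v \<bullet> e = 0} g \<and>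
        \<Omega> \<inter> ball z r = {x \<in> ball z r. x \<bullet> e > g (x - (x \<bullet> e) *\<^sub>R e)})"

section \<open>Sobolev spaces\<close>

definition partial :: "'n \<Rightarrow> (real^'n \<Rightarrow> real) \<Rightarrow> real^'n \<Rightarrow> real" where
  "partial i \<phi> x = frechet_derivative \<phi> (at x) (axis i 1)"

primrec Ck :: "nat \<Rightarrow> (real^'n \<Rightarrow> real) \<Rightarrow> bool" where
  "Ck 0 \<phi> \<longleftrightarrow> continuous_on UNIV \<phi>"
| "Ck (Suc k) \<phi> \<longleftrightarrow> \<phi> differentiable_on UNIV \<and> (\<forall>i. Ck k (partial i \<phi>))"

definition test_function :: "(real^'n) set \<Rightarrow> (real^'n \<Rightarrow> real) \<Rightarrow> bool" where
  "test_function \<Omega> \<phi> \<longleftrightarrow>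
     (\<forall>k. Ck k \<phi>) \<and> compact (closure {x. \<phi> x \<noteq> 0}) \<and> closure {x. \<phi> x \<noteq> 0} \<subseteq> \<Omega>"

text \<open>\<open>v\<close> is a (locally integrable) weak \<open>i\<close>-th partial derivative of the locally integrable \<open>u\<close>.\<close>

definition weak_partial ::
  "(real^'n) set \<Rightarrow> 'n \<Rightarrow> (real^'n \<Rightarrow> real) \<Rightarrow> (real^'n \<Rightarrow> real) \<Rightarrow> bool" where
  "weak_partial \<Omega> i u v \<longleftrightarrow>
     (\<forall>K. compact K \<and> K \<subseteq> \<Omega> \<longrightarrow> u absolutely_integrable_on K \<and> v absolutely_integrable_on K) \<and>
     (\<forall>\<phi>. test_function \<Omega> \<phi> \<longrightarrow>
        (\<integral>x. u x * partial i \<phi> x \<partial>(lebesgue_on \<Omega>)) = - (\<integral>x. v x * \<phi> x \<partial>(lebesgue_on \<Omega>)))"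

text \<open>A representative of the weak derivative, which is unique almost everywhere if it exists.\<close>

definition wderiv :: "(real^'n) set \<Rightarrow> 'n \<Rightarrow> (real^'n \<Rightarrow> real) \<Rightarrow> real^'n \<Rightarrow> real" where
  "wderiv \<Omega> i u = (SOME v. weak_partial \<Omega> i u v)"

definition W1p :: "real \<Rightarrow> (real^'n) set \<Rightarrow> (real^'n \<Rightarrow> real) set" where
  "W1p p \<Omega> = {u \<in> Lp p \<Omega>. \<forall>i. weak_partial \<Omega> i u (wderiv \<Omega> i u) \<and> wderiv \<Omega> i u \<in> Lp p \<Omega>}"

definition W1p_norm :: "real \<Rightarrow> (real^'n) set \<Rightarrow> (real^'n \<Rightarrow> real) \<Rightarrow> real" where
  "W1p_norm p \<Omega> u =
     (Lp_norm p \<Omega> u powr p + (\<Sum>i\<in>UNIV. Lp_norm p \<Omega> (wderiv \<Omega> i u) powr p)) powr (1 / p)"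

text \<open>
  The closure of the test functions in \<^term>\<open>W1p p \<Omega>\<close>. The norm convergence of \<open>\<phi> n\<close> to \<open>u\<close> is
  written componentwise, with the classical derivatives of \<open>\<phi> n\<close>, which are also its weak ones.
\<close>

definition W1p0 :: "real \<Rightarrow> (real^'n) set \<Rightarrow> (real^'n \<Rightarrow> real) set" where
  "W1p0 p \<Omega> = {u \<in> W1p p \<Omega>. \<exists>\<phi> :: nat \<Rightarrow> real^'n \<Rightarrow> real.
     (\<forall>n. test_function \<Omega> (\<phi> n)) \<and>
     (\<lambda>n. Lp_norm p \<Omega> (\<lambda>x. \<phi> n x - u x)) \<longlonglongrightarrow> 0 \<and>
     (\<forall>i. (\<lambda>n. Lp_norm p \<Omega> (\<lambda>x. partial i (\<phi> n) x - wderiv \<Omega> i u x)) \<longlonglongrightarrow> 0)}"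

definition embeds_in_L2 :: "real \<Rightarrow> (real^'n) set \<Rightarrow> bool" where
  "embeds_in_L2 q \<Omega> \<longleftrightarrow>
     W1p0 q \<Omega> \<subseteq> Lp 2 \<Omega> \<and> (\<exists>C. \<forall>w \<in> W1p0 q \<Omega>. Lp_norm 2 \<Omega> w \<le> C * W1p_norm q \<Omega> w)"

section \<open>Differential operator, nonlinearities, state and adjoint equation\<close>

definition elliptic_form ::
  "(real^'n) set \<Rightarrow> (real^'n \<Rightarrow> real^'n^'n) \<Rightarrow> (real^'n \<Rightarrow> real) \<Rightarrow> (real^'n \<Rightarrow> real) \<Rightarrow> real" where
  "elliptic_form \<Omega> a y z =
     (\<integral>x. (\<Sum>i\<in>UNIV. \<Sum>j\<in>UNIV. a x $ i $ j * wderiv \<Omega> i y x * wderiv \<Omega> j z x)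
        \<partial>(lebesgue_on \<Omega>))"

definition elliptic_coefficients :: "(real^'n) set \<Rightarrow> (real^'n \<Rightarrow> real^'n^'n) \<Rightarrow> bool" where
  "elliptic_coefficients \<Omega> a \<longleftrightarrow>
     (\<forall>i j. continuous_on (closure \<Omega>) (\<lambda>x. a x $ i $ j)) \<and>
     (\<exists>\<Lambda>>0. AE x in lebesgue_on \<Omega>. \<forall>\<xi> :: real^'n.
        (\<Sum>i\<in>UNIV. \<Sum>j\<in>UNIV. a x $ i $ j * \<xi> $ i * \<xi> $ j) \<ge> \<Lambda> * (norm \<xi>)\<^sup>2)"

definition caratheodory :: "(real^'n) set \<Rightarrow> (real^'n \<Rightarrow> real \<Rightarrow> real \<Rightarrow> real) \<Rightarrow> bool" where
  "caratheodory \<Omega> g \<longleftrightarrow>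
     (\<forall>y u. (\<lambda>x. g x y u) \<in> borel_measurable (lebesgue_on \<Omega>)) \<and>
     (AE x in lebesgue_on \<Omega>. continuous_on UNIV (\<lambda>(y, u). g x y u))"

definition deriv_y ::
  "(real^'n \<Rightarrow> real \<Rightarrow> real \<Rightarrow> real) \<Rightarrow> real^'n \<Rightarrow> real \<Rightarrow> real \<Rightarrow> real" where
  "deriv_y g x y u = deriv (\<lambda>\<eta>. g x \<eta> u) y"

definition growth_conditions ::
  "(real^'n) set \<Rightarrow> (real^'n \<Rightarrow> real \<Rightarrow> real \<Rightarrow> real) \<Rightarrow>
     (real^'n \<Rightarrow> real \<Rightarrow> real \<Rightarrow> real) \<Rightarrow> bool" where
  "growth_conditions \<Omega> f L \<longleftrightarrow>
     (\<forall>M>0. \<exists>aM \<in> Lp 1 \<Omega>. \<exists>bM. \<exists>cM \<in> Lp 2 \<Omega>.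
        (\<forall>x\<in>\<Omega>. 0 \<le> aM x) \<and> 0 \<le> bM \<and> (\<forall>x\<in>\<Omega>. 0 \<le> cM x) \<and>
        (AE x in lebesgue_on \<Omega>. \<forall>u y. \<bar>y\<bar> \<le> M \<longrightarrow>
           \<bar>L x y u\<bar> + \<bar>deriv_y L x y u\<bar> \<le> aM x + bM * \<bar>u\<bar>\<^sup>2 \<and>
           \<bar>f x y u\<bar> + \<bar>deriv_y f x y u\<bar> \<le> cM x + bM * \<bar>u\<bar>))"

definition nonlinearities ::
  "(real^'n) set \<Rightarrow> (real^'n \<Rightarrow> real \<Rightarrow> real \<Rightarrow> real) \<Rightarrow>
     (real^'n \<Rightarrow> real \<Rightarrow> real \<Rightarrow> real) \<Rightarrow> bool" where
  "nonlinearities \<Omega> f L \<longleftrightarrow>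
     caratheodory \<Omega> f \<and> caratheodory \<Omega> L \<and>
     (AE x in lebesgue_on \<Omega>. \<forall>u.
        (\<lambda>y. f x y u) C1_differentiable_on UNIV \<and> (\<lambda>y. L x y u) C1_differentiable_on UNIV) \<and>
     (AE x in lebesgue_on \<Omega>. \<forall>y u. deriv_y f x y u \<le> 0) \<and>
     growth_conditions \<Omega> f L"

text \<open>Here and below, \<open>q\<close> is the conjugate exponent of \<open>p\<close>.\<close>

definition weak_state ::
  "real \<Rightarrow> real \<Rightarrow> (real^'n) set \<Rightarrow> (real^'n \<Rightarrow> real^'n^'n) \<Rightarrow>
     (real^'n \<Rightarrow> real \<Rightarrow> real \<Rightarrow> real) \<Rightarrow> (real^'n \<Rightarrow> real) \<Rightarrow> (real^'n \<Rightarrow> real) \<Rightarrow> bool" where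
  "weak_state p q \<Omega> a f u y \<longleftrightarrow>
     y \<in> W1p0 p \<Omega> \<and>
     (\<forall>z \<in> W1p0 q \<Omega>. elliptic_form \<Omega> a y z = (\<integral>x. f x (y x) (u x) * z x \<partial>(lebesgue_on \<Omega>)))"

text \<open>
  A representative of the weak solution, which exists for \<open>u\<close> in \<open>Lp 2 \<Omega>\<close> and is unique up to
  null sets (for suitable \<open>p\<close>).
\<close>

definition state ::
  "real \<Rightarrow> real \<Rightarrow> (real^'n) set \<Rightarrow> (real^'n \<Rightarrow> real^'n^'n) \<Rightarrow>
     (real^'n \<Rightarrow> real \<Rightarrow> real \<Rightarrow> real) \<Rightarrow> (real^'n \<Rightarrow> real) \<Rightarrow> real^'n \<Rightarrow> real" where
  "state p q \<Omega> a f u = (SOME y. weak_state p q \<Omega> a f u y)"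

definition weak_adjoint ::
  "real \<Rightarrow> real \<Rightarrow> (real^'n) set \<Rightarrow> (real^'n \<Rightarrow> real^'n^'n) \<Rightarrow>
     (real^'n \<Rightarrow> real \<Rightarrow> real \<Rightarrow> real) \<Rightarrow> (real^'n \<Rightarrow> real \<Rightarrow> real \<Rightarrow> real) \<Rightarrow>
     (real^'n \<Rightarrow> real) \<Rightarrow> (real^'n \<Rightarrow> real) \<Rightarrow> (real^'n \<Rightarrow> real) \<Rightarrow> bool" where
  "weak_adjoint p q \<Omega> a f L u y \<phi> \<longleftrightarrow>
     \<phi> \<in> W1p0 q \<Omega> \<and>
     (\<forall>z \<in> W1p0 p \<Omega>. elliptic_form \<Omega> a z \<phi> =
        (\<integral>x. (deriv_y f x (y x) (u x) * \<phi> x + deriv_y L x (y x) (u x)) * z x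
           \<partial>(lebesgue_on \<Omega>)))"

section \<open>The control problem\<close>

definition J ::
  "real \<Rightarrow> real \<Rightarrow> (real^'n) set \<Rightarrow> (real^'n \<Rightarrow> real^'n^'n) \<Rightarrow>
     (real^'n \<Rightarrow> real \<Rightarrow> real \<Rightarrow> real) \<Rightarrow> (real^'n \<Rightarrow> real \<Rightarrow> real \<Rightarrow> real) \<Rightarrow>
     (real^'n \<Rightarrow> real) \<Rightarrow> real" where
  "J p q \<Omega> a f L u = (\<integral>x. L x (state p q \<Omega> a f u x) (u x) \<partial>(lebesgue_on \<Omega>))"

definition local_solution ::
  "real \<Rightarrow> real \<Rightarrow> (real^'n) set \<Rightarrow> real \<Rightarrow> (real^'n \<Rightarrow> real^'n^'n) \<Rightarrow>
     (real^'n \<Rightarrow> real \<Rightarrow> real \<Rightarrow> real) \<Rightarrow> (real^'n \<Rightarrow> real \<Rightarrow> real \<Rightarrow> real) \<Rightarrow>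
     (real^'n \<Rightarrow> real) \<Rightarrow> bool" where
  "local_solution p q \<Omega> \<tau> a f L ubar \<longleftrightarrow>
     ubar \<in> Lp 2 \<Omega> \<and> norm0 \<Omega> ubar \<le> \<tau> \<and>
     (\<exists>r>0. \<forall>u \<in> Lp 2 \<Omega>. norm0 \<Omega> u \<le> \<tau> \<and> Lp_norm 2 \<Omega> (\<lambda>x. u x - ubar x) < r \<longrightarrow>
        J p q \<Omega> a f L ubar \<le> J p q \<Omega> a f L u)"

definition hamiltonian ::
  "(real^'n \<Rightarrow> real \<Rightarrow> real \<Rightarrow> real) \<Rightarrow> (real^'n \<Rightarrow> real \<Rightarrow> real \<Rightarrow> real) \<Rightarrow>
     real^'n \<Rightarrow> real \<Rightarrow> real \<Rightarrow> real \<Rightarrow> real" where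
  "hamiltonian L f x y u \<phi> = L x y u + \<phi> * f x y u"

end

theory Submission
  imports Defs
begin

text \<open>
  Since \<open>p > d\<close>, the state is bounded, so the growth conditions make the Hamiltonian
  integrable along every square integrable control. Changing the control on a set that does not
  enlarge its support gives minimality where it is nonzero. Next, compare the gain
  \<open>H(x, 0) - H(x, ubar x)\<close> on the support with the gain \<open>H(x, 0) - H(x, r)\<close> available
  off the support. As Lebesgue measure has no atoms, pieces of equal measure can be exchanged, so
  optimality forbids the first gain to be below and the second to be above the same threshold \<open>c\<close>,
  each on a set of positive measure. The multiplier is \<open>- s\<close>, the largest \<open>c\<close> that is almost
  everywhere a lower bound of the first gain. If the support constraint is inactive, the support
  can be enlarged, and \<open>s = 0\<close>.
\<close>

section \<open>Morrey's estimate\<close>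

text \<open>Young's inequality with a free weight \<open>s\<close>: if
  \<open>s * a powr (p - 1) \<ge> 1\<close>, the first summand alone dominates \<open>a\<close>;
  otherwise \<open>a\<close> is at most the second.\<close>

lemma le_powr_scaled:
  fixes a s p :: real
  assumes "0 \<le> a" "0 < s" "1 < p"
  shows "a \<le> s * a powr p + s powr (- 1 / (p - 1))"
proof (cases "s * a powr (p - 1) \<ge> 1")
  case True
  then have "a > 0" using assms by (cases "a = 0") auto
  then have "a powr p = a * a powr (p - 1)" by (simp add: powr_mult_base)
  moreover have "a \<le> a * (s * a powr (p - 1))" using True \<open>a > 0\<close> by simp
  ultimately have "a \<le> s * a powr p" by (simp add: mult_ac)
  then show ?thesis by (simp add: add_increasing2)
next
  case False
  then have "a powr (p - 1) \<le> 1 / s" using assms by (simp add: field_simps)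
  then have "(a powr (p - 1)) powr (1 / (p - 1)) \<le> (1 / s) powr (1 / (p - 1))"
    using assms by (intro powr_mono2) auto
  also have "(a powr (p - 1)) powr (1 / (p - 1)) = a"
    using assms by (simp add: powr_powr)
  also have "(1 / s) powr (1 / (p - 1)) = s powr (- 1 / (p - 1))"
    using assms by (simp add: powr_divide powr_minus_divide)
  finally show ?thesis using assms by (smt (verit) powr_ge_zero mult_nonneg_nonneg)
qed

text \<open>Substitution \<open>z = x + t * w\<close> with Jacobian \<open>t ^ d\<close>. It removes
  the dependence on \<open>x\<close> and \<open>t\<close> from the inner integral, at the price of a
  singular factor in \<open>t\<close>.\<close>

lemma nn_integral_lborel_affine:
  fixes f :: "'a::euclidean_space \<Rightarrow> ennreal"
  assumes [measurable]: "f \<in> borel_measurable borel" and t: "t > 0"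
  shows "(\<integral>\<^sup>+w. f (x + t *\<^sub>R w) \<partial>lborel) = ennreal (1 / t ^ DIM('a)) * (\<integral>\<^sup>+z. f z \<partial>lborel)"
proof -
  have "(\<integral>\<^sup>+z. f z \<partial>lborel) = ennreal (t ^ DIM('a)) * (\<integral>\<^sup>+w. f (x + t *\<^sub>R w) \<partial>lborel)"
    using t by (subst lborel_affine[of t x])
      (simp_all add: nn_integral_density nn_integral_distr nn_integral_cmult)
  then show ?thesis
    using t by (simp add: mult.assoc[symmetric] ennreal_mult'[symmetric])
qed

lemma nn_integral_powr_unit:
  assumes "a > - 1"
  shows "(\<integral>\<^sup>+t. ennreal (t powr a) * indicator {0..1::real} t \<partial>lborel) = ennreal (1 / (a + 1))"
  using nn_integral_has_integral_lebesgue'[OF _ has_integral_powr_from_0[OF assms, of 1]] by simp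

text \<open>
  The weight \<open>t powr ((p + d) / 2 - 1)\<close> in Young's inequality makes both resulting powers of \<open>t\<close>
  integrable at \<open>0\<close>; this is possible exactly because \<open>p > d\<close>.
\<close>

lemma nn_integral_segments_le:
  fixes G :: "'a::euclidean_space \<Rightarrow> real"
  assumes G: "continuous_on UNIV G" "\<And>z. 0 \<le> G z" and p: "real DIM('a) < p"
    and K[measurable]: "K \<in> sets borel"
  shows "(\<integral>\<^sup>+w. (\<integral>\<^sup>+t. ennreal (G (x + t *\<^sub>R w)) * indicator {0..1} t \<partial>lborel) * indicator K w \<partial>lborel)
    \<le> ennreal (2 / (p - DIM('a))) * (\<integral>\<^sup>+z. ennreal (G z powr p) \<partial>lborel)
      + ennreal (2 * (p - 1) / (p - DIM('a))) * emeasure lborel K"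
proof -
  define d where "d = real DIM('a)"
  \<comment> \<open>Integrability at 0 of both powers of \<open>t\<close> asks for
    \<open>d - 1 < \<alpha> < p - 1\<close>; this is the midpoint.\<close>
  define \<alpha> where "\<alpha> = (p + d) / 2 - 1"
  define \<beta> where "\<beta> = \<alpha> / (p - 1)"
  have d1: "d \<ge> 1" unfolding d_def using DIM_positive[where 'a='a] by linarith
  have p1: "p > 1" "p > d" using d1 p unfolding d_def by linarith+
  have \<alpha>: "\<alpha> - d > - 1" "\<alpha> - d + 1 = (p - d) / 2" using p1 d1 by (auto simp: \<alpha>_def field_simps)
  have \<beta>: "- \<beta> > - 1" "- \<beta> + 1 = (p - d) / (2 * (p - 1))"
    using p1 d1 by (auto simp: \<beta>_def \<alpha>_def field_simps)
  have [measurable]: "G \<in> borel_measurable borel"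
    using G by (simp add: borel_measurable_continuous_onI)
  let ?I = "\<lambda>t::real. indicator {0..1} t :: ennreal"
  let ?P = "\<lambda>w t. ennreal (t powr \<alpha>) * ?I t * ennreal (G (x + t *\<^sub>R w) powr p)"
  let ?Q = "\<lambda>w t. ennreal (t powr (- \<beta>)) * ?I t"
  \<comment> \<open>At \<open>t = 0\<close> both powers are 0 by the convention for
    \<open>powr\<close>, so the bound can fail there; this single point is a null set.\<close>
  have young: "ennreal (G (x + t *\<^sub>R w)) * ?I t \<le> ?P w t + ?Q w t" if "t \<noteq> 0" for w t
  proof (cases "t \<in> {0..1}")
    case True
    then have "G (x + t *\<^sub>R w) \<le> t powr \<alpha> * G (x + t *\<^sub>R w) powr p + t powr (- \<beta>)"
      using le_powr_scaled[of "G (x + t *\<^sub>R w)" "t powr \<alpha>" p] G that p1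
      by (simp add: powr_powr \<beta>_def)
    then show ?thesis using True
      by (simp add: ennreal_mult'[symmetric] ennreal_plus[symmetric] ennreal_leI del: ennreal_plus)
  qed auto
  have "(\<integral>\<^sup>+w. (\<integral>\<^sup>+t. ennreal (G (x + t *\<^sub>R w)) * ?I t \<partial>lborel) * indicator K w \<partial>lborel)
     \<le> (\<integral>\<^sup>+w. (\<integral>\<^sup>+t. ?P w t + ?Q w t \<partial>lborel) * indicator K w \<partial>lborel)"
    using AE_lborel_singleton[of "0::real"]
    by (intro nn_integral_mono mult_right_mono nn_integral_mono_AE) (auto elim!: eventually_mono intro: young)
  also have "\<dots> = (\<integral>\<^sup>+w. (\<integral>\<^sup>+t. ?P w t \<partial>lborel) * indicator K w
        + (\<integral>\<^sup>+t. ?Q w t \<partial>lborel) * indicator K w \<partial>lborel)"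
    by (intro nn_integral_cong) (simp add: nn_integral_add distrib_right)
  also have "\<dots> = (\<integral>\<^sup>+w. (\<integral>\<^sup>+t. ?P w t \<partial>lborel) * indicator K w \<partial>lborel)
        + (\<integral>\<^sup>+w. (\<integral>\<^sup>+t. ?Q w t \<partial>lborel) * indicator K w \<partial>lborel)"
    by (rule nn_integral_add) measurable
  also have "\<dots> \<le> (\<integral>\<^sup>+w. (\<integral>\<^sup>+t. ?P w t \<partial>lborel) \<partial>lborel)
        + ennreal (2 * (p - 1) / (p - d)) * emeasure lborel K"
  proof (intro add_mono)
    show "(\<integral>\<^sup>+w. (\<integral>\<^sup>+t. ?P w t \<partial>lborel) * indicator K w \<partial>lborel)
        \<le> (\<integral>\<^sup>+w. (\<integral>\<^sup>+t. ?P w t \<partial>lborel) \<partial>lborel)"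
      by (intro nn_integral_mono) (auto simp: indicator_def)
    show "(\<integral>\<^sup>+w. (\<integral>\<^sup>+t. ?Q w t \<partial>lborel) * indicator K w \<partial>lborel)
        \<le> ennreal (2 * (p - 1) / (p - d)) * emeasure lborel K"
      using nn_integral_powr_unit[OF \<beta>(1)] \<beta>(2) by (simp add: nn_integral_cmult)
  qed
  \<comment> \<open>With \<open>t\<close> outermost, the inner integral over \<open>w\<close> can be
    rescaled to one over \<open>z\<close>, which leaves the weight
    \<open>t powr (\<alpha> - d)\<close>.\<close>
  also have "(\<integral>\<^sup>+w. (\<integral>\<^sup>+t. ?P w t \<partial>lborel) \<partial>lborel) = (\<integral>\<^sup>+t. (\<integral>\<^sup>+w. ?P w t \<partial>lborel) \<partial>lborel)"
    by (rule lborel_pair.Fubini'[symmetric]) (simp add: borel_prod case_prod_unfold)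
  also have "\<dots> = (\<integral>\<^sup>+t. (ennreal (t powr (\<alpha> - d)) * ?I t) * (\<integral>\<^sup>+z. ennreal (G z powr p) \<partial>lborel) \<partial>lborel)"
  proof (rule nn_integral_cong_AE, use AE_lborel_singleton[of "0::real"] in eventually_elim)
    fix t :: real assume "t \<noteq> 0"
    show "(\<integral>\<^sup>+w. ?P w t \<partial>lborel)
      = (ennreal (t powr (\<alpha> - d)) * ?I t) * (\<integral>\<^sup>+z. ennreal (G z powr p) \<partial>lborel)"
    proof (cases "t \<in> {0..1}")
      case True
      with \<open>t \<noteq> 0\<close> have t: "t > 0" by simp
      have "ennreal (t powr \<alpha>) * ennreal (1 / t ^ DIM('a)) = ennreal (t powr (\<alpha> - d))"
        using t by (simp add: ennreal_mult'[symmetric] powr_diff d_def powr_realpow)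
      then show ?thesis using True
        by (simp add: nn_integral_cmult nn_integral_lborel_affine[OF _ t, of "\<lambda>z. ennreal (G z powr p)"]
            mult.assoc[symmetric])
    qed simp
  qed
  also have "\<dots> = ennreal (2 / (p - d)) * (\<integral>\<^sup>+z. ennreal (G z powr p) \<partial>lborel)"
    using nn_integral_powr_unit[OF \<alpha>(1)] \<alpha>(2) by (simp add: nn_integral_multc)
  finally show ?thesis unfolding d_def by (simp add: add_right_mono)
qed

section \<open>Test functions and their increments along segments\<close>

lemma test_function_C1:
  assumes "test_function \<Omega> \<phi>"
  shows "\<phi> differentiable_on UNIV" "continuous_on UNIV (partial i \<phi>)"
proof -
  have "Ck (Suc 0) \<phi>" using assms unfolding test_function_def by (elim conjE allE)
  then have *: "\<phi> differentiable_on UNIV \<and> (\<forall>i. continuous_on UNIV (partial i \<phi>))" unfolding Ck.simps .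
  show "\<phi> differentiable_on UNIV" by (rule conjunct1[OF *])
  show "continuous_on UNIV (partial i \<phi>)" by (rule spec[OF conjunct2[OF *]])
qed

text \<open>A point outside \<Omega> lies in the open complement of the closed support. There \<phi>
  vanishes locally, so its derivative vanishes as well.\<close>

lemma test_functionD:
  assumes "test_function \<Omega> \<phi>"
  shows "\<phi> differentiable (at x)" "continuous_on UNIV \<phi>" "continuous_on UNIV (partial i \<phi>)"
    "x \<notin> \<Omega> \<Longrightarrow> \<phi> x = 0" "x \<notin> \<Omega> \<Longrightarrow> partial i \<phi> x = 0"
proof -
  note C1 = test_function_C1[OF assms]
  show "continuous_on UNIV (partial i \<phi>)" by (rule C1)
  show "\<phi> differentiable (at x)"
    using C1(1) by (simp add: differentiable_on_def)
  show "continuous_on UNIV \<phi>" by (rule differentiable_imp_continuous_on[OF C1(1)])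
  have S: "closure {x. \<phi> x \<noteq> 0} \<subseteq> \<Omega>" using assms unfolding test_function_def by (elim conjE)
  have zero: "\<phi> y = 0" if "y \<notin> closure {x. \<phi> x \<noteq> 0}" for y
    using that subsetD[OF closure_subset, of y "{x. \<phi> x \<noteq> 0}"] by blast
  show "x \<notin> \<Omega> \<Longrightarrow> \<phi> x = 0" using S by (intro zero) blast
  assume "x \<notin> \<Omega>"
  then have x: "x \<notin> closure {x. \<phi> x \<noteq> 0}" using S by blast
  have "(\<phi> has_derivative (\<lambda>_. 0)) (at x)"
  proof (rule has_derivative_transform_within_open)
    show "open (- closure {x. \<phi> x \<noteq> 0})" by (rule open_Compl[OF closed_closure])
    show "x \<in> - closure {x. \<phi> x \<noteq> 0}" by (rule iffD2[OF Compl_iff x])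
    show "((\<lambda>_. 0) has_derivative (\<lambda>_. 0)) (at x)" by (rule has_derivative_const)
    show "0 = \<phi> y" if "y \<in> - closure {x. \<phi> x \<noteq> 0}" for y by (rule zero[symmetric], rule ComplD[OF that])
  qed
  then have "frechet_derivative \<phi> (at x) = (\<lambda>_. 0)" by (rule frechet_derivative_at[symmetric])
  then show "partial i \<phi> x = 0" unfolding partial_def by (rule fun_cong)
qed

lemma frechet_derivative_eq_sum_partial:
  assumes "\<phi> differentiable (at x)"
  shows "frechet_derivative \<phi> (at x) w = (\<Sum>i\<in>UNIV. w $ i * partial i \<phi> x)"
proof -
  have lin: "linear (frechet_derivative \<phi> (at x))" using assms by (rule linear_frechet_derivative)
  have "frechet_derivative \<phi> (at x) w
      = frechet_derivative \<phi> (at x) (\<Sum>i\<in>UNIV. w $ i *\<^sub>R axis i 1)"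
    by (simp add: basis_expansion flip: scalar_mult_eq_scaleR)
  then show ?thesis
    using lin by (simp add: linear_sum linear_scale partial_def)
qed

text \<open>As \<phi> vanishes at the end point \<open>x + w\<close>, the fundamental theorem of
  calculus expresses \<open>\<phi> x\<close> by the derivative along the segment, and every
  component of \<open>w\<close> is at most \<open>R\<close>. The bound is in \<open>ennreal\<close>,
  ready to be averaged over \<open>w\<close>.\<close>

lemma test_function_segment:
  fixes x w :: "real^'n"
  assumes \<phi>: "test_function \<Omega> \<phi>" and "x + w \<notin> \<Omega>" "norm w \<le> R"
  shows "ennreal \<bar>\<phi> x\<bar>
    \<le> ennreal R * (\<Sum>i\<in>UNIV. \<integral>\<^sup>+t. ennreal \<bar>partial i \<phi> (x + t *\<^sub>R w)\<bar> * indicator {0..1} t \<partial>lborel)"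
proof -
  have R: "R \<ge> 0" using assms(3) norm_ge_zero[of w] by linarith
  define g where "g t = (\<Sum>i\<in>UNIV. w $ i * partial i \<phi> (x + t *\<^sub>R w))" for t
  define G where "G t = R * (\<Sum>i\<in>UNIV. \<bar>partial i \<phi> (x + t *\<^sub>R w)\<bar>)" for t
  have line: "continuous_on UNIV (\<lambda>t. x + t *\<^sub>R w)" by (intro continuous_intros)
  have cont: "continuous_on UNIV (\<lambda>t. partial i \<phi> (x + t *\<^sub>R w))" for i
    using continuous_on_compose2[OF test_functionD(3)[OF \<phi>] line] by simp
  have [measurable]: "(\<lambda>t. partial i \<phi> (x + t *\<^sub>R w)) \<in> borel_measurable borel" for i
    using cont by (rule borel_measurable_continuous_onI)
  have m: "(\<lambda>t. ennreal \<bar>partial i \<phi> (x + t *\<^sub>R w)\<bar> * indicator {0..1} t)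
      \<in> borel_measurable lborel" for i
    by measurable
  have "((\<lambda>t. \<phi> (x + t *\<^sub>R w)) has_vector_derivative g t) (at t within {0..1})" for t
  proof -
    have "(\<phi> has_derivative frechet_derivative \<phi> (at (x + t *\<^sub>R w))) (at (x + t *\<^sub>R w))"
      using test_functionD(1)[OF \<phi>] by (simp add: frechet_derivative_works)
    moreover have "((\<lambda>t. x + t *\<^sub>R w) has_vector_derivative w) (at t within {0..1})"
      unfolding has_vector_derivative_def by (rule derivative_eq_intros refl | simp)+
    ultimately have "((\<phi> \<circ> (\<lambda>t. x + t *\<^sub>R w)) has_vector_derivative
        frechet_derivative \<phi> (at (x + t *\<^sub>R w)) w) (at t within {0..1})"
      by (intro vector_derivative_diff_chain_within) (auto intro: has_derivative_at_withinI)
    then show ?thesis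
      using test_functionD(1)[OF \<phi>] by (simp add: o_def frechet_derivative_eq_sum_partial g_def)
  qed
  then have "(g has_integral \<phi> (x + 1 *\<^sub>R w) - \<phi> (x + 0 *\<^sub>R w)) {0..1}"
    by (intro fundamental_theorem_of_calculus) auto
  then have int: "integral {0..1} g = - \<phi> x" "g integrable_on {0..1}"
    using test_functionD(4)[OF \<phi> assms(2)] by (auto simp: integral_unique has_integral_integrable)
  have "continuous_on {0..1} G" unfolding G_def
    by (intro continuous_intros continuous_on_subset[OF cont]) auto
  then have Gi: "G integrable_on {0..1}" by (rule integrable_continuous_real)
  have G0: "0 \<le> G t" for t using R by (simp add: G_def sum_nonneg)
  have "norm (g t) \<le> G t" for t
  proof -
    have "\<bar>g t\<bar> \<le> (\<Sum>i\<in>UNIV. R * \<bar>partial i \<phi> (x + t *\<^sub>R w)\<bar>)"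
      unfolding g_def
    proof (rule order_trans[OF sum_abs sum_mono])
      fix i :: 'n
      have "\<bar>w $ i\<bar> \<le> R" using component_le_norm_cart[of w i] assms(3) by linarith
      then show "\<bar>w $ i * partial i \<phi> (x + t *\<^sub>R w)\<bar> \<le> R * \<bar>partial i \<phi> (x + t *\<^sub>R w)\<bar>"
        by (simp add: abs_mult mult_right_mono)
    qed
    then show ?thesis by (simp add: G_def sum_distrib_left)
  qed
  then have "norm (integral {0..1} g) \<le> integral {0..1} G"
    by (intro integral_norm_bound_integral int Gi)
  then have "\<bar>\<phi> x\<bar> \<le> integral {0..1} G" using int by simp
  then have "ennreal \<bar>\<phi> x\<bar> \<le> ennreal (integral {0..1} G)" by (rule ennreal_leI)
  also have "\<dots> = (\<integral>\<^sup>+t. ennreal (G t) * indicator {0..1} t \<partial>lborel)"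
    by (rule nn_integral_has_integral_lebesgue'[OF G0 integrable_integral[OF Gi], symmetric])
  also have "\<dots> = (\<integral>\<^sup>+t. ennreal R *
      (\<Sum>i\<in>UNIV. ennreal \<bar>partial i \<phi> (x + t *\<^sub>R w)\<bar> * indicator {0..1} t) \<partial>lborel)"
    using R by (intro nn_integral_cong) (auto simp: G_def ennreal_mult sum_nonneg indicator_def)
  also have "\<dots> = ennreal R *
      (\<Sum>i\<in>UNIV. \<integral>\<^sup>+t. ennreal \<bar>partial i \<phi> (x + t *\<^sub>R w)\<bar> * indicator {0..1} t \<partial>lborel)"
    by (simp only: nn_integral_cmult nn_integral_sum borel_measurable_sum m)
  finally show ?thesis .
qed

text \<open>
  Morrey's estimate. The value at \<open>x\<close> is minus the increment of \<open>\<phi>\<close> along each segment from \<open>x\<close>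
  to a point outside \<open>\<Omega>\<close>; these are averaged over a whole ball of end points.
\<close>

lemma test_function_bound:
  fixes \<Omega> :: "(real^'n) set"
  assumes "bounded \<Omega>" and p: "real CARD('n) < p"
  obtains C where "0 \<le> C" "\<And>\<phi> x. test_function \<Omega> \<phi> \<Longrightarrow> ennreal \<bar>\<phi> x\<bar>
    \<le> ennreal C * (1 + (\<Sum>i\<in>UNIV. \<integral>\<^sup>+z. ennreal (\<bar>partial i \<phi> z\<bar> powr p) \<partial>lborel))"
proof -
  obtain R where R: "R > 0" "\<And>x. x \<in> \<Omega> \<Longrightarrow> norm x \<le> R"
    using assms(1) bounded_pos by metis
  \<comment> \<open>All vectors of \<open>K\<close> have length between \<open>3 * R\<close> and
    \<open>5 * R\<close>, while two points of \<Omega> are at most \<open>2 * R\<close> apart. Hence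
    adding such a vector leads out of \<Omega> from every point of \<Omega>. The index
    \<open>undefined\<close> is an arbitrary coordinate direction.\<close>
  define K where "K = ball ((4 * R) *\<^sub>R (axis undefined 1 :: real^'n)) R"
  define k where "k = measure lborel K"
  define n where "n = real CARD('n)"
  define c1 where "c1 = 2 / (p - n)"
  define c2 where "c2 = 2 * (p - 1) / (p - n)"
  have p1: "p > n" "p > 1"
    using p zero_less_card_finite[where 'a='n] unfolding n_def by linarith+
  have c: "c1 \<ge> 0" "c2 \<ge> 0" "n \<ge> 0" using p1 by (auto simp: c1_def c2_def n_def)
  have k: "k > 0" "emeasure lborel K = ennreal k"
  proof -
    show "k > 0" unfolding k_def K_def by (rule content_ball_pos[OF R(1)])
    show "emeasure lborel K = ennreal k"
      unfolding k_def K_def using emeasure_lborel_ball_finite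
      by (intro emeasure_eq_ennreal_measure less_imp_neq) simp
  qed
  have norm_K: "3 * R < norm w \<and> norm w \<le> 5 * R" if "w \<in> K" for w
  proof -
    let ?v = "(4 * R) *\<^sub>R (axis undefined 1 :: real^'n)"
    have "norm ?v = 4 * R" using R by (simp add: norm_axis_1)
    moreover have "norm (?v - w) < R" using that by (simp add: K_def dist_norm)
    ultimately show ?thesis
      using norm_triangle_ineq3[of ?v w] by linarith
  qed
  have out: "x + w \<notin> \<Omega>" if "x \<in> \<Omega>" "w \<in> K" for x w
  proof
    assume "x + w \<in> \<Omega>"
    then have "norm w \<le> R + R"
      using R(2)[of "x + w"] R(2)[OF that(1)] norm_triangle_ineq4[of "x + w" x] by simp
    then show False using norm_K[OF that(2)] R(1) by linarith
  qed
  \<comment> \<open>\<open>5 * R\<close> bounds the lengths of the segments and \<open>1 / k\<close>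
    averages over \<open>K\<close>. The sum \<open>c1 + n * c2 * k\<close> dominates both the factor
    of the integrals and the constant term, so a single constant can be factored out.\<close>
  define C where "C = 5 * R * (c1 + n * c2 * k) / k"
  show ?thesis
  proof (rule that)
    show "0 \<le> C" using c R k by (auto simp: C_def)
    fix \<phi> and x :: "real^'n" assume \<phi>: "test_function \<Omega> \<phi>"
    define I where "I i = (\<integral>\<^sup>+z. ennreal (\<bar>partial i \<phi> z\<bar> powr p) \<partial>lborel)" for i
    define T where "T i w = (\<integral>\<^sup>+t. ennreal \<bar>partial i \<phi> (x + t *\<^sub>R w)\<bar> * indicator {0..1} t \<partial>lborel)" for i w
    have [measurable]: "partial i \<phi> \<in> borel_measurable borel" for i
      using test_functionD(3)[OF \<phi>] by (rule borel_measurable_continuous_onI)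
    have [measurable]: "T i \<in> borel_measurable borel" for i
      unfolding T_def by measurable
    have [measurable]: "K \<in> sets borel" by (simp add: K_def)
    have m: "(\<lambda>w. T i w * indicator K w) \<in> borel_measurable lborel" for i
      by measurable
    have seg: "(\<integral>\<^sup>+w. T i w * indicator K w \<partial>lborel) \<le> ennreal c1 * I i + ennreal c2 * ennreal k" for i
      unfolding T_def I_def k(2)[symmetric] c1_def c2_def n_def
      using nn_integral_segments_le[of "\<lambda>z. \<bar>partial i \<phi> z\<bar>" p K x] test_functionD(3)[OF \<phi>] p
      by (simp add: continuous_on_rabs)
    show "ennreal \<bar>\<phi> x\<bar> \<le> ennreal C * (1 + (\<Sum>i\<in>UNIV. I i))"
    proof (cases "x \<in> \<Omega>")
      case True
      have "ennreal \<bar>\<phi> x\<bar> * ennreal k = (\<integral>\<^sup>+w. ennreal \<bar>\<phi> x\<bar> * indicator K w \<partial>lborel)"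
        using k by (simp add: nn_integral_cmult_indicator)
      also have "\<dots> \<le> (\<integral>\<^sup>+w. ennreal (5 * R) * (\<Sum>i\<in>UNIV. T i w * indicator K w) \<partial>lborel)"
      proof (intro nn_integral_mono)
        fix w
        show "ennreal \<bar>\<phi> x\<bar> * indicator K w \<le> ennreal (5 * R) * (\<Sum>i\<in>UNIV. T i w * indicator K w)"
          using test_function_segment[OF \<phi> out[OF True], of w "5 * R"] norm_K[of w]
          by (auto simp: T_def indicator_def)
      qed
      also have "\<dots> = ennreal (5 * R) * (\<Sum>i\<in>UNIV. \<integral>\<^sup>+w. T i w * indicator K w \<partial>lborel)"
        by (simp only: nn_integral_cmult nn_integral_sum borel_measurable_sum m)
      also have "\<dots> \<le> ennreal (5 * R) * (\<Sum>i\<in>UNIV. ennreal c1 * I i + ennreal c2 * ennreal k)"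
        by (intro mult_left_mono sum_mono seg) auto
      also have "\<dots> = ennreal (5 * R) * (ennreal c1 * (\<Sum>i\<in>UNIV. I i) + ennreal (n * c2 * k))"
      proof -
        have "ennreal (n * c2 * k) = of_nat CARD('n) * (ennreal c2 * ennreal k)"
          using c k by (simp add: n_def ennreal_mult mult.assoc ennreal_of_nat_eq_real_of_nat)
        then show ?thesis by (simp only: sum.distrib sum_distrib_left[symmetric] sum_constant mult.left_commute)
      qed
      also have "\<dots> \<le> ennreal (5 * R) * (ennreal (c1 + n * c2 * k) * (\<Sum>i\<in>UNIV. I i)
          + ennreal (c1 + n * c2 * k) * 1)"
      proof (intro mult_left_mono add_mono mult_right_mono)
        show "ennreal c1 \<le> ennreal (c1 + n * c2 * k)" using c k by (intro ennreal_leI) simp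
        show "ennreal (n * c2 * k) \<le> ennreal (c1 + n * c2 * k) * 1"
          using c by (simp add: ennreal_leI)
      qed auto
      also have "\<dots> = ennreal (5 * R * (c1 + n * c2 * k)) * (1 + (\<Sum>i\<in>UNIV. I i))"
      proof -
        have "ennreal (5 * R * (c1 + n * c2 * k)) = ennreal (5 * R) * ennreal (c1 + n * c2 * k)"
          using R by (intro ennreal_mult') simp
        then show ?thesis by (simp only: distrib_left mult.assoc add.commute mult_1_right)
      qed
      finally have "ennreal \<bar>\<phi> x\<bar> * ennreal k * ennreal (1 / k)
          \<le> ennreal (5 * R * (c1 + n * c2 * k)) * (1 + (\<Sum>i\<in>UNIV. I i)) * ennreal (1 / k)"
        by (rule mult_right_mono) simp
      also have "\<dots> = ennreal C * (1 + (\<Sum>i\<in>UNIV. I i))"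
      proof -
        have "ennreal C = ennreal (5 * R * (c1 + n * c2 * k)) * ennreal (1 / k)"
          using c k R by (simp add: C_def ennreal_mult'[symmetric])
        then show ?thesis by (simp only: mult_ac)
      qed
      also have "ennreal \<bar>\<phi> x\<bar> * ennreal k * ennreal (1 / k) = ennreal \<bar>\<phi> x\<bar>"
        using k by (simp add: mult.assoc ennreal_mult'[symmetric])
      finally show ?thesis .
    qed (simp add: test_functionD(4)[OF \<phi>])
  qed
qed

section \<open>Boundedness of Sobolev functions\<close>

lemma LpD:
  assumes "u \<in> Lp p \<Omega>"
  shows "u \<in> borel_measurable (lebesgue_on \<Omega>)" "integrable (lebesgue_on \<Omega>) (\<lambda>x. \<bar>u x\<bar> powr p)"
  using assms by (auto simp: Lp_def)

text \<open>Estimating by twice the maximum avoids convexity and so covers all exponents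
  \<open>p \<ge> 0\<close>.\<close>

lemma abs_diff_powr_le:
  fixes a b p :: real
  assumes "0 \<le> p"
  shows "\<bar>a - b\<bar> powr p \<le> 2 powr p * (\<bar>a\<bar> powr p + \<bar>b\<bar> powr p)"
proof -
  have "\<bar>a - b\<bar> powr p \<le> (2 * max \<bar>a\<bar> \<bar>b\<bar>) powr p" using assms by (intro powr_mono2) auto
  also have "\<dots> = 2 powr p * max \<bar>a\<bar> \<bar>b\<bar> powr p" by (simp add: powr_mult)
  also have "max \<bar>a\<bar> \<bar>b\<bar> powr p \<le> \<bar>a\<bar> powr p + \<bar>b\<bar> powr p" by (simp add: max_def)
  finally show ?thesis by simp
qed

lemma Lp_diff:
  assumes "u \<in> Lp p \<Omega>" "v \<in> Lp p \<Omega>" "0 \<le> p"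
  shows "(\<lambda>x. u x - v x) \<in> Lp p \<Omega>"
proof -
  note [measurable] = LpD(1)[OF assms(1)] LpD(1)[OF assms(2)]
  have "integrable (lebesgue_on \<Omega>) (\<lambda>x. 2 powr p * (\<bar>u x\<bar> powr p + \<bar>v x\<bar> powr p))"
    using LpD(2)[OF assms(1)] LpD(2)[OF assms(2)] by auto
  then have "integrable (lebesgue_on \<Omega>) (\<lambda>x. \<bar>u x - v x\<bar> powr p)"
    by (rule Bochner_Integration.integrable_bound)
      (use abs_diff_powr_le[OF assms(3)] in \<open>auto simp: abs_of_nonneg\<close>)
  then show ?thesis by (simp add: Lp_def)
qed

lemma Lp_bounded_on:
  assumes "\<Omega> \<in> lmeasurable" "u \<in> borel_measurable (lebesgue_on \<Omega>)" "\<And>x. x \<in> \<Omega> \<Longrightarrow> \<bar>u x\<bar> \<le> B" "0 \<le> p"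
  shows "u \<in> Lp p \<Omega>"
proof -
  interpret finite_measure "lebesgue_on \<Omega>" using assms(1) by (rule finite_measure_lebesgue_on)
  note [measurable] = assms(2)
  have "integrable (lebesgue_on \<Omega>) (\<lambda>x. \<bar>u x\<bar> powr p)"
    by (rule integrable_const_bound[of _ "B powr p"])
      (use assms(3,4) in \<open>auto intro!: AE_I2 powr_mono2\<close>)
  then show ?thesis using assms(2) by (simp add: Lp_def)
qed

lemma Lp_norm_powr:
  assumes "0 < p"
  shows "Lp_norm p \<Omega> u powr p = (\<integral>x. \<bar>u x\<bar> powr p \<partial>(lebesgue_on \<Omega>))"
  using assms by (simp add: Lp_norm_def powr_powr)

text \<open>Meant for \<open>u\<close> a derivative of an approximating test function and
  \<open>v\<close> the derivative of the limit: closeness of the two then bounds the former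
  uniformly along the sequence.\<close>

lemma nn_integral_powr_diff_le:
  assumes "u \<in> Lp p \<Omega>" "v \<in> Lp p \<Omega>" "0 < p"
  shows "(\<integral>\<^sup>+x. ennreal (\<bar>u x\<bar> powr p) \<partial>(lebesgue_on \<Omega>))
    \<le> ennreal (2 powr p * (Lp_norm p \<Omega> (\<lambda>x. u x - v x) powr p + Lp_norm p \<Omega> v powr p))"
proof -
  have p: "0 \<le> p" using assms by simp
  have d: "integrable (lebesgue_on \<Omega>) (\<lambda>x. \<bar>u x - v x\<bar> powr p)"
    using Lp_diff[OF assms(1,2) p] by (rule LpD)
  have le: "\<bar>u x\<bar> powr p \<le> 2 powr p * (\<bar>u x - v x\<bar> powr p + \<bar>v x\<bar> powr p)" for x
    using abs_diff_powr_le[OF p, of "u x - v x" "- v x"] by simp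
  have "(\<integral>x. \<bar>u x\<bar> powr p \<partial>(lebesgue_on \<Omega>))
      \<le> (\<integral>x. 2 powr p * (\<bar>u x - v x\<bar> powr p + \<bar>v x\<bar> powr p) \<partial>(lebesgue_on \<Omega>))"
    using d LpD(2)[OF assms(1)] LpD(2)[OF assms(2)] le by (intro integral_mono) auto
  also have "\<dots> = 2 powr p * (Lp_norm p \<Omega> (\<lambda>x. u x - v x) powr p + Lp_norm p \<Omega> v powr p)"
    using d LpD(2)[OF assms(2)] assms(3) by (simp add: Lp_norm_powr)
  finally show ?thesis
    using LpD(2)[OF assms(1)] by (simp add: nn_integral_eq_integral ennreal_leI)
qed

text \<open>Links the integrals over \<Omega> in the Sobolev norms with those over the whole space
  in Morrey's estimate.\<close>

lemma nn_integral_lebesgue_on_eq_lborel: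
  assumes "\<Omega> \<in> sets lebesgue" "f \<in> borel_measurable borel" "\<And>x. x \<notin> \<Omega> \<Longrightarrow> f x = 0"
  shows "(\<integral>\<^sup>+x. f x \<partial>(lebesgue_on \<Omega>)) = (\<integral>\<^sup>+x. f x \<partial>lborel)"
proof -
  have "(\<integral>\<^sup>+x. f x \<partial>(lebesgue_on \<Omega>)) = (\<integral>\<^sup>+x. f x * indicator \<Omega> x \<partial>lebesgue)"
    using assms(1) by (intro nn_integral_restrict_space) simp
  also have "\<dots> = (\<integral>\<^sup>+x. f x \<partial>lebesgue)"
    using assms(3) by (intro nn_integral_cong) (auto simp: indicator_def)
  finally show ?thesis by (simp add: nn_integral_completion)
qed

lemma Lp_continuous_vanishing:
  assumes \<Omega>: "open \<Omega>" "bounded \<Omega>" and g: "continuous_on UNIV g" "\<And>x. x \<notin> \<Omega> \<Longrightarrow> g x = 0" and "0 \<le> p"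
  shows "g \<in> Lp p \<Omega>"
proof -
  have "compact (g ` closure \<Omega>)"
    using \<Omega>(2) by (intro compact_continuous_image continuous_on_subset[OF g(1)]) auto
  then obtain B where "\<And>x. x \<in> closure \<Omega> \<Longrightarrow> \<bar>g x\<bar> \<le> B"
    using compact_imp_bounded bounded_iff by (metis imageI real_norm_def)
  then have B: "\<bar>g x\<bar> \<le> B" if "x \<in> \<Omega>" for x using that closure_subset by blast
  have [measurable]: "g \<in> borel_measurable borel" using g(1) by (rule borel_measurable_continuous_onI)
  have "g \<in> borel_measurable lebesgue" by (rule measurable_completion) simp
  then have "g \<in> borel_measurable (lebesgue_on \<Omega>)" by (rule measurable_restrict_space1)
  moreover have "\<Omega> \<in> lmeasurable"
    using \<Omega> lmeasurable_open by blast
  ultimately show ?thesis using B assms(5) Lp_bounded_on by blast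
qed

text \<open>Approximating test functions have eventually bounded gradients in
  \<open>Lp p \<Omega>\<close>, so Morrey's estimate gives them a common bound \<open>M\<close>.
  Convergence in \<open>Lp p \<Omega>\<close> passes a bound on to \<open>y\<close> by a Chebyshev
  argument, without a subsequence that converges almost everywhere.\<close>

lemma W1p0_bounded:
  fixes \<Omega> :: "(real^'n) set"
  assumes \<Omega>: "open \<Omega>" "bounded \<Omega>" and p: "real CARD('n) < p" and y: "y \<in> W1p0 p \<Omega>"
  obtains M where "0 < M" "AE x in lebesgue_on \<Omega>. \<bar>y x\<bar> \<le> M"
proof -
  have p0: "0 < p" using p by (rule le_less_trans[OF of_nat_0_le_iff])
  have lm: "\<Omega> \<in> lmeasurable" using \<Omega> lmeasurable_open by blast
  then have sets: "\<Omega> \<in> sets lebesgue" by blast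
  interpret finite_measure "lebesgue_on \<Omega>" using lm by (rule finite_measure_lebesgue_on)
  from y obtain \<phi> where \<phi>: "\<And>n. test_function \<Omega> (\<phi> n)"
      and lim: "(\<lambda>n. Lp_norm p \<Omega> (\<lambda>x. \<phi> n x - y x)) \<longlonglongrightarrow> 0"
      and dlim: "\<And>i. (\<lambda>n. Lp_norm p \<Omega> (\<lambda>x. partial i (\<phi> n) x - wderiv \<Omega> i y x)) \<longlonglongrightarrow> 0"
    unfolding W1p0_def by blast
  from y have yp: "y \<in> Lp p \<Omega>" and wp: "\<And>i. wderiv \<Omega> i y \<in> Lp p \<Omega>"
    unfolding W1p0_def W1p_def by blast+
  have \<phi>p: "\<phi> n \<in> Lp p \<Omega>" for n
    using p0 test_functionD[OF \<phi>] by (intro Lp_continuous_vanishing[OF \<Omega>]) auto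
  have dp: "partial i (\<phi> n) \<in> Lp p \<Omega>" for i n
    using p0 test_functionD[OF \<phi>] by (intro Lp_continuous_vanishing[OF \<Omega>]) auto
  obtain C where C: "0 \<le> C" "\<And>\<phi> x. test_function \<Omega> \<phi> \<Longrightarrow> ennreal \<bar>\<phi> x\<bar>
      \<le> ennreal C * (1 + (\<Sum>i\<in>UNIV. \<integral>\<^sup>+z. ennreal (\<bar>partial i \<phi> z\<bar> powr p) \<partial>lborel))"
    using test_function_bound[OF \<Omega>(2) p] by blast
  define W where "W i = 2 powr p * (1 + Lp_norm p \<Omega> (wderiv \<Omega> i y) powr p)" for i
  define M where "M = C * (1 + (\<Sum>i\<in>UNIV. W i))"
  have W0: "0 \<le> W i" for i by (simp add: W_def)
  have M0: "0 \<le> M" using C(1) W0 by (simp add: M_def sum_nonneg)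
  \<comment> \<open>The distance 1 reached here is the summand 1 in \<open>W i\<close>.\<close>
  have "\<forall>\<^sub>F n in sequentially. \<forall>i\<in>UNIV. Lp_norm p \<Omega> (\<lambda>x. partial i (\<phi> n) x - wderiv \<Omega> i y x) < 1"
    by (intro eventually_ball_finite ballI order_tendstoD(2)[OF dlim]) auto
  then have bound: "\<forall>\<^sub>F n in sequentially. \<forall>x. \<bar>\<phi> n x\<bar> \<le> M"
  proof eventually_elim
    case (elim n)
    have "(\<integral>\<^sup>+z. ennreal (\<bar>partial i (\<phi> n) z\<bar> powr p) \<partial>lborel) \<le> ennreal (W i)" for i
    proof -
      have [measurable]: "partial i (\<phi> n) \<in> borel_measurable borel"
        using test_functionD(3)[OF \<phi>] by (rule borel_measurable_continuous_onI)
      have "(\<integral>\<^sup>+z. ennreal (\<bar>partial i (\<phi> n) z\<bar> powr p) \<partial>lborel)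
          = (\<integral>\<^sup>+z. ennreal (\<bar>partial i (\<phi> n) z\<bar> powr p) \<partial>(lebesgue_on \<Omega>))"
        using test_functionD(5)[OF \<phi>] by (intro nn_integral_lebesgue_on_eq_lborel[symmetric] sets) auto
      also have "\<dots> \<le> ennreal (2 powr p * (Lp_norm p \<Omega> (\<lambda>x. partial i (\<phi> n) x - wderiv \<Omega> i y x) powr p
          + Lp_norm p \<Omega> (wderiv \<Omega> i y) powr p))"
        by (rule nn_integral_powr_diff_le[OF dp wp p0])
      also have "\<dots> \<le> ennreal (W i)"
      proof -
        have "Lp_norm p \<Omega> (\<lambda>x. partial i (\<phi> n) x - wderiv \<Omega> i y x) powr p \<le> 1 powr p"
          using elim p0 by (intro powr_mono2) (auto simp: Lp_norm_def less_imp_le)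
        then show ?thesis unfolding W_def by (intro ennreal_leI mult_left_mono add_right_mono) auto
      qed
      finally show ?thesis .
    qed
    then have le: "(\<Sum>i\<in>UNIV. \<integral>\<^sup>+z. ennreal (\<bar>partial i (\<phi> n) z\<bar> powr p) \<partial>lborel) \<le> (\<Sum>i\<in>UNIV. ennreal (W i))"
      by (rule sum_mono)
    show ?case
    proof
      fix x
      have "ennreal \<bar>\<phi> n x\<bar> \<le> ennreal C * (1 + (\<Sum>i\<in>UNIV. ennreal (W i)))"
        by (rule order_trans[OF C(2)[OF \<phi>]], intro mult_left_mono add_left_mono le) auto
      also have "\<dots> = ennreal M"
        using C(1) W0 by (simp add: M_def ennreal_mult' sum_nonneg)
      finally show "\<bar>\<phi> n x\<bar> \<le> M" using M0 by simp
    qed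
  qed
  \<comment> \<open>The gap 1 above \<open>M\<close> forces \<open>\<phi> n\<close> and
    \<open>y\<close> to differ by at least 1 on \<open>E\<close>, so the measure of \<open>E\<close>
    is bounded by the integral of the \<open>p\<close>-th power of their difference, which tends to
    0.\<close>
  define E where "E = {x \<in> \<Omega>. M + 1 < \<bar>y x\<bar>}"
  note [measurable] = LpD(1)[OF yp] LpD(1)[OF \<phi>p]
  have E: "E \<in> sets (lebesgue_on \<Omega>)"
  proof -
    have "{x \<in> space (lebesgue_on \<Omega>). M + 1 < \<bar>y x\<bar>} \<in> sets (lebesgue_on \<Omega>)" by measurable
    then show ?thesis by (simp add: E_def)
  qed
  have "\<forall>\<^sub>F n in sequentially. measure (lebesgue_on \<Omega>) E powr (1 / p) \<le> Lp_norm p \<Omega> (\<lambda>x. \<phi> n x - y x)"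
    using bound
  proof eventually_elim
    case (elim n)
    have "measure (lebesgue_on \<Omega>) E = (\<integral>x. indicator E x \<partial>(lebesgue_on \<Omega>))"
      using E sets.sets_into_space[OF E] by (simp add: Int_absorb2)
    also have "\<dots> \<le> (\<integral>x. \<bar>\<phi> n x - y x\<bar> powr p \<partial>(lebesgue_on \<Omega>))"
    proof (rule integral_mono)
      show "integrable (lebesgue_on \<Omega>) (\<lambda>x. \<bar>\<phi> n x - y x\<bar> powr p)"
        using Lp_diff[OF \<phi>p yp] p0 by (auto dest: LpD)
      show "indicator E x \<le> \<bar>\<phi> n x - y x\<bar> powr p" for x
      proof (cases "x \<in> E")
        case True
        then have "M + 1 < \<bar>y x\<bar>" by (simp add: E_def)
        moreover have "\<bar>\<phi> n x\<bar> \<le> M" using elim by (rule spec)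
        ultimately have "1 \<le> \<bar>\<phi> n x - y x\<bar>" by linarith
        then show ?thesis using True p0 by (simp add: ge_one_powr_ge_zero)
      qed simp
    qed (use E sets.sets_into_space[OF E] in \<open>simp add: Int_absorb2 integrable_indicator_iff less_top[symmetric]\<close>)
    finally show ?case
      unfolding Lp_norm_def using p0 by (intro powr_mono2) auto
  qed
  then have "measure (lebesgue_on \<Omega>) E powr (1 / p) \<le> 0"
    by (intro tendsto_lowerbound[OF lim]) auto
  then have "measure (lebesgue_on \<Omega>) E = 0" by (simp add: powr_nonneg_iff)
  then have "E \<in> null_sets (lebesgue_on \<Omega>)" using E by (simp add: null_sets_def emeasure_eq_measure)
  then have "AE x in lebesgue_on \<Omega>. \<bar>y x\<bar> \<le> M + 1"
    by (rule AE_I') (auto simp: E_def)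
  then show ?thesis using that[of "M + 1"] M0 by simp
qed

section \<open>Atomlessness and superposition measurability\<close>

text \<open>Intersecting \<open>A\<close> with balls about the origin of growing radius yields
  measures that run continuously from 0 to that of \<open>A\<close>; the intermediate value theorem
  finds the radius.\<close>

lemma lmeasurable_subset_of_measure:
  fixes A :: "'a::euclidean_space set"
  assumes A: "A \<in> lmeasurable" "bounded A" and m: "0 \<le> m" "m \<le> measure lebesgue A"
  obtains B where "B \<subseteq> A" "B \<in> lmeasurable" "measure lebesgue B = m"
proof -
  obtain R where R: "R > 0" "A \<subseteq> ball 0 R"
    using A(2) bounded_subset_ballD by blast
  define F where "F r = measure lebesgue (A \<inter> ball 0 r)" for r
  define G where "G r = unit_ball_vol (real DIM('a)) * r ^ DIM('a)" for r
  have AB: "A \<inter> ball 0 r \<in> lmeasurable" for r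
    using A(1) by (intro fmeasurable.Int) auto
  \<comment> \<open>The increments of \<open>F\<close> are at most the volumes of the corresponding
    spherical shells, so \<open>F\<close> inherits continuity from the polynomial
    \<open>G\<close>.\<close>
  have le: "dist (F s) (F r) \<le> dist (G s) (G r)" if "0 \<le> r" "r \<le> s" for r s
  proof -
    have G: "measure lebesgue (ball (0::'a) t) = G t" if "0 \<le> t" for t
      using content_ball[OF that, of "0::'a"] by (simp add: G_def)
    have sub: "(A \<inter> ball 0 s) - (A \<inter> ball 0 r) \<subseteq> ball 0 s - ball 0 r" by auto
    have inc: "A \<inter> ball 0 r \<subseteq> A \<inter> ball 0 s" "ball (0::'a) r \<subseteq> ball 0 s" using that by auto
    have "F s - F r = measure lebesgue ((A \<inter> ball 0 s) - (A \<inter> ball 0 r))"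
      unfolding F_def by (rule measurable_measure_Diff[OF AB fmeasurableD[OF AB] inc(1), symmetric])
    also have "\<dots> \<le> measure lebesgue (ball (0::'a) s - ball 0 r)"
      by (intro measure_mono_fmeasurable[OF sub] fmeasurable.Diff fmeasurableD AB) auto
    also have "\<dots> = G s - G r"
      using G that by (subst measurable_measure_Diff[OF _ _ inc(2)]) auto
    finally have "F s - F r \<le> G s - G r" .
    moreover have "F r \<le> F s"
      unfolding F_def by (intro measure_mono_fmeasurable[OF inc(1)] fmeasurableD AB)
    ultimately show ?thesis by (simp add: dist_real_def)
  qed
  have le': "dist (F s) (F r) \<le> dist (G s) (G r)" if "0 \<le> r" "0 \<le> s" for r s
    using le[of r s] le[of s r] that by (cases "r \<le> s") (auto simp: dist_commute)
  have "continuous_on {0..R} G" unfolding G_def by (intro continuous_intros)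
  then have "continuous_on {0..R} F"
    unfolding continuous_on_iff by (fastforce intro: order_le_less_trans[OF le'])
  moreover have "F 0 \<le> m" using m by (simp add: F_def)
  moreover have "m \<le> F R" using R m by (simp add: F_def Int_absorb2)
  ultimately obtain r where "F r = m" using R IVT'[of F 0 m R] by auto
  then show ?thesis using that[of "A \<inter> ball 0 r"] AB by (auto simp: F_def)
qed

text \<open>Lebesgue measure is complete, so a change on a null set preserves measurability;
  extension by 0 reduces the claim to the whole space.\<close>

lemma borel_measurable_lebesgue_on_AE:
  fixes f g :: "'a::euclidean_space \<Rightarrow> 'b::euclidean_space"
  assumes \<Omega>: "\<Omega> \<in> sets lebesgue" and f: "f \<in> borel_measurable (lebesgue_on \<Omega>)"
    and eq: "AE x in lebesgue_on \<Omega>. f x = g x"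
  shows "g \<in> borel_measurable (lebesgue_on \<Omega>)"
proof -
  have "AE x in lebesgue. (if x \<in> \<Omega> then f x else 0) = (if x \<in> \<Omega> then g x else 0)"
    using eq \<Omega> by (simp add: AE_restrict_space_iff)
  then show ?thesis
    using borel_measurable_AE[of "\<lambda>x. if x \<in> \<Omega> then f x else 0" "\<lambda>x. if x \<in> \<Omega> then g x else 0"] f
    unfolding borel_measurable_if[OF \<Omega>] by simp
qed

lemma floor_scaled_approx:
  fixes d t :: real
  assumes "0 < d"
  shows "\<bar>real_of_int \<lfloor>d * t\<rfloor> / d - t\<bar> \<le> 1 / d"
proof -
  have "real_of_int \<lfloor>d * t\<rfloor> / d - t = (real_of_int \<lfloor>d * t\<rfloor> - d * t) / d"
    using assms by (simp add: diff_divide_distrib)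
  moreover have "\<bar>real_of_int \<lfloor>d * t\<rfloor> - d * t\<bar> \<le> 1" by linarith
  ultimately show ?thesis using assms by (simp add: abs_divide divide_right_mono)
qed

text \<open>Rounding \<open>y\<close> and \<open>u\<close> down to multiples of
  \<open>1 / Suc k\<close> leaves countably many values, for which composition is measurable. By
  joint continuity in the last two arguments, the rounded compositions converge almost
  everywhere.\<close>

lemma caratheodory_measurable:
  assumes \<Omega>: "\<Omega> \<in> sets lebesgue" and g: "caratheodory \<Omega> g"
    and "y \<in> borel_measurable (lebesgue_on \<Omega>)" "u \<in> borel_measurable (lebesgue_on \<Omega>)"
  shows "(\<lambda>x. g x (y x) (u x)) \<in> borel_measurable (lebesgue_on \<Omega>)"
proof -
  define q where "q k t = real_of_int \<lfloor>real (Suc k) * t\<rfloor> / real (Suc k)" for k t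
  have q: "(\<lambda>k. q k t) \<longlonglongrightarrow> t" for t
  proof (rule LIMSEQ_I)
    fix e :: real assume "0 < e"
    then obtain N where N: "inverse (real (Suc N)) < e" using reals_Archimedean by blast
    have "norm (q k t - t) < e" if "k \<ge> N" for k
    proof -
      have "norm (q k t - t) \<le> 1 / real (Suc k)"
        unfolding q_def real_norm_def by (rule floor_scaled_approx) (rule of_nat_0_less_iff[THEN iffD2, OF zero_less_Suc])
      also have "\<dots> \<le> inverse (real (Suc N))"
        unfolding inverse_eq_divide by (rule divide_left_mono) (use that in simp_all)
      finally show ?thesis using N by linarith
    qed
    then show "\<exists>no. \<forall>n\<ge>no. norm (q n t - t) < e" by blast
  qed
  have gm: "(\<lambda>x. g x a b) \<in> borel_measurable (lebesgue_on \<Omega>)" for a b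
    using g unfolding caratheodory_def by blast
  have fl: "(\<lambda>x. \<lfloor>real (Suc k) * v x\<rfloor>) \<in> measurable (lebesgue_on \<Omega>) (count_space UNIV)"
    if "v \<in> borel_measurable (lebesgue_on \<Omega>)" for k v
    using that by measurable
  have qm: "(\<lambda>x. g x (q k (y x)) (q k (u x))) \<in> borel_measurable (lebesgue_on \<Omega>)" for k
  proof -
    let ?c = "\<lambda>i. real_of_int i / real (Suc k)"
    have "(\<lambda>x. g x (?c i) (?c \<lfloor>real (Suc k) * u x\<rfloor>)) \<in> borel_measurable (lebesgue_on \<Omega>)" for i
      by (rule measurable_compose_countable[where f="\<lambda>j x. g x (?c i) (?c j)", OF gm fl[OF assms(4)]])
    from measurable_compose_countable[where f="\<lambda>i x. g x (?c i) (?c \<lfloor>real (Suc k) * u x\<rfloor>)",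
        OF this fl[OF assms(3)]]
    show ?thesis unfolding q_def .
  qed
  have "AE x in lebesgue_on \<Omega>. continuous_on UNIV (\<lambda>(y, u). g x y u)"
    using g unfolding caratheodory_def by blast
  \<comment> \<open>The total function \<open>lim\<close> is measurable even where the sequence
    diverges; such points form a null set.\<close>
  then have ae: "AE x in lebesgue_on \<Omega>. lim (\<lambda>k. g x (q k (y x)) (q k (u x))) = g x (y x) (u x)"
  proof eventually_elim
    case (elim x)
    have "(\<lambda>k. (\<lambda>(y, u). g x y u) (q k (y x), q k (u x))) \<longlonglongrightarrow> (\<lambda>(y, u). g x y u) (y x, u x)"
      by (rule continuous_on_tendsto_compose[OF elim tendsto_Pair[OF q q]]) simp_all
    then show ?case by (intro limI) (simp only: prod.case)
  qed
  have meas: "(\<lambda>x. lim (\<lambda>k. g x (q k (y x)) (q k (u x)))) \<in> borel_measurable (lebesgue_on \<Omega>)"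
    by (rule borel_measurable_lim_metric[OF qm])
  show ?thesis by (rule borel_measurable_lebesgue_on_AE[OF \<Omega> meas ae])
qed

text \<open>Turns optimality, an inequality between integrals, into a pointwise statement: were
  \<open>E\<close> not null, the integral would be negative.\<close>

lemma null_set_of_negative_integrand:
  fixes e :: "'a \<Rightarrow> real"
  assumes e: "integrable M e" "0 \<le> (\<integral>x. e x \<partial>M)" and E: "E \<in> sets M"
    and neg: "\<And>x. x \<in> E \<Longrightarrow> e x < 0" "\<And>x. x \<in> space M - E \<Longrightarrow> e x = 0"
  shows "E \<in> null_sets M"
proof -
  have nonneg: "AE x in M. 0 \<le> - e x" using neg by (intro AE_I2) force
  then have "0 \<le> (\<integral>x. - e x \<partial>M)" by (rule integral_nonneg_AE)
  then have "(\<integral>x. - e x \<partial>M) = 0" using e by simp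
  then have "AE x in M. - e x = 0"
    using integral_nonneg_eq_0_iff_AE[OF _ nonneg] e(1) by simp
  then have "AE x in M. x \<notin> E" by eventually_elim (use neg(1) in force)
  then show ?thesis using E by (simp add: AE_iff_null_sets)
qed

text \<open>Comparison with rational values suffices, so only countably many exceptional null sets
  have to be united.\<close>

lemma continuous_le_of_rationals:
  fixes f :: "real \<Rightarrow> real"
  assumes "continuous_on UNIV f" "\<And>r. r \<in> \<rat> \<Longrightarrow> c \<le> f r"
  shows "c \<le> f u"
  by (rule continuous_ge_on_closure[of "\<rat>"]) (use assms in \<open>simp_all add: Rats_closure_real\<close>)

section \<open>The exchange argument\<close>

text \<open>\<open>h x u\<close> stands for the Hamiltonian along the optimal state and adjoint state.\<close>

locale sparse_minimizer =
  fixes \<Omega> :: "(real^'n) set" and h :: "real^'n \<Rightarrow> real \<Rightarrow> real" and \<tau> :: real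
    and ubar :: "real^'n \<Rightarrow> real"
  assumes domain: "\<Omega> \<in> sets lebesgue" "bounded \<Omega>"
    and cont: "AE x in lebesgue_on \<Omega>. continuous_on UNIV (h x)"
    and int: "\<And>v. v \<in> Lp 2 \<Omega> \<Longrightarrow> integrable (lebesgue_on \<Omega>) (\<lambda>x. h x (v x))"
    and ubar: "ubar \<in> Lp 2 \<Omega>" "norm0 \<Omega> ubar \<le> \<tau>" and tau: "0 < \<tau>"
    and opt: "\<And>v. v \<in> Lp 2 \<Omega> \<Longrightarrow> norm0 \<Omega> v \<le> \<tau> \<Longrightarrow>
      (\<integral>x. h x (ubar x) \<partial>(lebesgue_on \<Omega>)) \<le> (\<integral>x. h x (v x) \<partial>(lebesgue_on \<Omega>))"
begin

section \<open>Measurability and modified controls\<close>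

abbreviation "M \<equiv> lebesgue_on \<Omega>"

lemma lmeasurable: "\<Omega> \<in> lmeasurable"
  using domain by (intro bounded_set_imp_lmeasurable)

sublocale finite_measure M
  using lmeasurable by (rule finite_measure_lebesgue_on)

lemma sets_M_iff: "E \<in> sets M \<longleftrightarrow> E \<subseteq> \<Omega> \<and> E \<in> lmeasurable"
proof -
  have "E \<in> sets M \<longleftrightarrow> E \<subseteq> \<Omega> \<and> E \<in> sets lebesgue"
    using domain by (subst sets_restrict_space_iff) auto
  then show ?thesis
    using bounded_set_imp_lmeasurable[OF bounded_subset[OF domain(2)]] fmeasurableD by blast
qed

lemma measure_M: "E \<subseteq> \<Omega> \<Longrightarrow> measure M E = measure lebesgue E"
  using domain by (intro measure_restrict_space) auto

lemma norm0_eq: "norm0 \<Omega> v = measure M {x \<in> \<Omega>. v x \<noteq> 0}"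
  unfolding norm0_def by (rule measure_M[symmetric]) blast

lemma ubar_measurable [measurable]: "ubar \<in> borel_measurable M"
  using ubar(1) by (rule LpD)

lemma const_Lp: "(\<lambda>_. r) \<in> Lp 2 \<Omega>"
  by (rule Lp_bounded_on[OF lmeasurable, of _ "\<bar>r\<bar>"]) auto

lemma h_measurable [measurable]:
  "(\<lambda>x. h x r) \<in> borel_measurable M" "(\<lambda>x. h x (ubar x)) \<in> borel_measurable M"
  using int[OF const_Lp] int[OF ubar(1)] by auto

lemma Collect_in_sets:
  assumes "Measurable.pred M P"
  shows "{x \<in> \<Omega>. P x} \<in> sets M"
  using predE[OF assms] by simp

lemma subset_of_measure:
  assumes "E \<in> sets M" "0 \<le> m" "m \<le> measure M E"
  obtains E' where "E' \<subseteq> E" "E' \<in> sets M" "measure M E' = m"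
proof -
  have E: "E \<subseteq> \<Omega>" "E \<in> lmeasurable" using assms(1) sets_M_iff by blast+
  have m: "m \<le> measure lebesgue E" using assms(3) measure_M[OF E(1)] by simp
  obtain B where B: "B \<subseteq> E" "B \<in> lmeasurable" "measure lebesgue B = m"
    by (rule lmeasurable_subset_of_measure[OF E(2) bounded_subset[OF domain(2) E(1)] assms(2) m])
  have "B \<subseteq> \<Omega>" using B(1) E(1) by (rule subset_trans)
  then show ?thesis
    using B measure_M[of B] by (intro that[of B]) (simp_all add: sets_M_iff)
qed

lemma modified_Lp:
  assumes "E \<in> sets M" "w \<in> Lp 2 \<Omega>"
  shows "(\<lambda>x. if x \<in> E then w x else ubar x) \<in> Lp 2 \<Omega>"
proof -
  note [measurable] = assms(1) LpD(1)[OF assms(2)]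
  have "integrable M (\<lambda>x. indicator E x * \<bar>w x\<bar> powr 2 + indicator (\<Omega> - E) x * \<bar>ubar x\<bar> powr 2)"
    using LpD(2)[OF assms(2)] LpD(2)[OF ubar(1)] assms(1) sets.compl_sets[OF assms(1)]
    by (intro Bochner_Integration.integrable_add integrable_real_mult_indicator[unfolded mult.commute[of _ "indicator _ _"]])
      simp_all
  then have "integrable M (\<lambda>x. \<bar>if x \<in> E then w x else ubar x\<bar> powr 2)"
    by (rule Bochner_Integration.integrable_cong[THEN iffD1, rotated -1]) (auto simp: indicator_def)
  moreover have "(\<lambda>x. if x \<in> E then w x else ubar x) \<in> borel_measurable M" by measurable
  ultimately show ?thesis by (simp add: Lp_def)
qed

text \<open>The competitor equals \<open>w\<close> on \<open>E\<close> and \<open>ubar\<close>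
  elsewhere, so the difference of the two objectives is an integral over \<open>E\<close>.\<close>

lemma modified_integral:
  assumes E: "E \<in> sets M" and w: "w \<in> Lp 2 \<Omega>"
    and le: "norm0 \<Omega> (\<lambda>x. if x \<in> E then w x else ubar x) \<le> \<tau>"
  shows "integrable M (\<lambda>x. indicator E x * (h x (w x) - h x (ubar x)))"
    "0 \<le> (\<integral>x. indicator E x * (h x (w x) - h x (ubar x)) \<partial>M)"
proof -
  let ?v = "\<lambda>x. if x \<in> E then w x else ubar x"
  have v: "?v \<in> Lp 2 \<Omega>" by (rule modified_Lp[OF E w])
  have eq: "indicator E x * (h x (w x) - h x (ubar x)) = h x (?v x) - h x (ubar x)" for x
    by (simp add: indicator_def)
  show "integrable M (\<lambda>x. indicator E x * (h x (w x) - h x (ubar x)))"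
    unfolding eq by (rule Bochner_Integration.integrable_diff[OF int[OF v] int[OF ubar(1)]])
  show "0 \<le> (\<integral>x. indicator E x * (h x (w x) - h x (ubar x)) \<partial>M)"
    unfolding eq Bochner_Integration.integral_diff[OF int[OF v] int[OF ubar(1)]]
    using opt[OF v le] by simp
qed

text \<open>Changing \<open>ubar\<close> to \<open>r\<close> at points where it is already nonzero
  cannot enlarge the support, so the competitor is admissible. The value \<open>r = 0\<close> is
  included.\<close>

lemma support_null: "{x \<in> \<Omega>. ubar x \<noteq> 0 \<and> h x r < h x (ubar x)} \<in> null_sets M"
proof -
  let ?E = "{x \<in> \<Omega>. ubar x \<noteq> 0 \<and> h x r < h x (ubar x)}"
  have E: "?E \<in> sets M" by (intro Collect_in_sets) measurable
  have "norm0 \<Omega> (\<lambda>x. if x \<in> ?E then r else ubar x) \<le> norm0 \<Omega> ubar"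
    unfolding norm0_eq by (intro finite_measure_mono Collect_in_sets) auto
  then have le: "norm0 \<Omega> (\<lambda>x. if x \<in> ?E then r else ubar x) \<le> \<tau>" using ubar(2) by linarith
  show ?thesis
    by (rule null_set_of_negative_integrand[OF modified_integral[OF E const_Lp le] E]) auto
qed

section \<open>Gains, their exchange and the multiplier\<close>

definition low_gain :: "real \<Rightarrow> (real^'n) set" where
  "low_gain c = {x \<in> \<Omega>. ubar x \<noteq> 0 \<and> h x 0 - h x (ubar x) < c}"

text \<open>A fixed trial value \<open>r\<close> takes the place of the infimum over all values, so
  no near-minimizer has to be selected measurably.\<close>

definition high_gain :: "real \<Rightarrow> real \<Rightarrow> (real^'n) set" where
  "high_gain r c = {x \<in> \<Omega>. ubar x = 0 \<and> c < h x 0 - h x r}"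

lemma gain_sets: "low_gain c \<in> sets M" "high_gain r c \<in> sets M"
proof -
  show "low_gain c \<in> sets M" unfolding low_gain_def by (intro Collect_in_sets) measurable
  show "high_gain r c \<in> sets M" unfolding high_gain_def by (intro Collect_in_sets) measurable
qed

text \<open>
  Support is moved from a set where it gains less than \<open>c\<close> to one where it would gain more than \<open>c\<close>.
\<close>

lemma exchange:
  assumes A: "A \<subseteq> high_gain r c" "A \<in> sets M" and B: "B \<subseteq> low_gain c" "B \<in> sets M"
    and le: "norm0 \<Omega> ubar - measure M B + measure M A \<le> \<tau>"
    and c: "c * measure M B \<le> c * measure M A"
  shows "A \<in> null_sets M"
proof -
  have sub: "A \<subseteq> \<Omega>" "B \<subseteq> \<Omega>" using A(1) B(1) by (auto simp: high_gain_def low_gain_def)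
  have disj: "A \<inter> B = {}" using A(1) B(1) by (auto simp: high_gain_def low_gain_def)
  have E: "A \<union> B \<in> sets M" using A(2) B(2) by blast
  \<comment> \<open>The competitor is \<open>r\<close> on \<open>A\<close>, 0 on \<open>B\<close>
    and \<open>ubar\<close> elsewhere: its support loses \<open>B\<close> and gains at most
    \<open>A\<close>.\<close>
  define w where "w x = (if x \<in> A then r else 0)" for x
  note [measurable] = A(2) B(2)
  have w: "w \<in> Lp 2 \<Omega>"
  proof (rule Lp_bounded_on[OF lmeasurable, of _ "\<bar>r\<bar>"])
    show "w \<in> borel_measurable M" unfolding w_def by measurable
  qed (simp_all add: w_def)
  have S: "{x \<in> \<Omega>. ubar x \<noteq> 0} \<in> sets M" by (intro Collect_in_sets) measurable
  have "norm0 \<Omega> (\<lambda>x. if x \<in> A \<union> B then w x else ubar x) \<le> measure M (({x \<in> \<Omega>. ubar x \<noteq> 0} - B) \<union> A)"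
    unfolding norm0_eq using S sub by (intro finite_measure_mono) (auto simp: w_def)
  also have "\<dots> \<le> measure M ({x \<in> \<Omega>. ubar x \<noteq> 0} - B) + measure M A"
    using S by (intro measure_Un_le) auto
  also have "measure M ({x \<in> \<Omega>. ubar x \<noteq> 0} - B) = norm0 \<Omega> ubar - measure M B"
    unfolding norm0_eq using S B by (intro finite_measure_Diff) (auto simp: low_gain_def)
  finally have le': "norm0 \<Omega> (\<lambda>x. if x \<in> A \<union> B then w x else ubar x) \<le> \<tau>" using le by linarith
  note f = modified_integral[OF E w le']
  have iA: "integrable M (indicator A :: _ \<Rightarrow> real)" "integrable M (indicator B :: _ \<Rightarrow> real)"
    by (simp_all add: less_top[symmetric])
  have mA: "(\<integral>x. indicator A x \<partial>M) = measure M A" "(\<integral>x. indicator B x \<partial>M) = measure M B"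
    using sub by (simp_all add: Int_absorb2)
  \<comment> \<open>The added term has integral \<open>c * (measure M A - measure M B)\<close>,
    which is nonnegative by the last hypothesis. It makes the integrand strictly negative on both
    sets: there \<open>h x r - h x 0 + c < 0\<close> and
    \<open>h x 0 - h x (ubar x) - c < 0\<close>, respectively.\<close>
  let ?e = "\<lambda>x. indicator (A \<union> B) x * (h x (w x) - h x (ubar x)) + (c * indicator A x - c * indicator B x)"
  have "integrable M ?e" using f(1) iA by simp
  moreover have "0 \<le> (\<integral>x. ?e x \<partial>M)" using f iA mA c by simp
  moreover have "?e x < 0" if "x \<in> A \<union> B" for x
    using that disj A(1) B(1) by (auto simp: w_def high_gain_def low_gain_def indicator_def)
  moreover have "?e x = 0" if "x \<in> space M - (A \<union> B)" for x
    using that by simp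
  ultimately have "A \<union> B \<in> null_sets M" by (intro null_set_of_negative_integrand[OF _ _ E])
  then show ?thesis using A(2) by (rule null_sets_subset) blast
qed

lemma multiplier_exists:
  "\<exists>c\<ge>0. c * (norm0 \<Omega> ubar - \<tau>) = 0 \<and> low_gain c \<in> null_sets M \<and> (\<forall>r. high_gain r c \<in> null_sets M)"
proof -
  have low0: "low_gain 0 \<in> null_sets M"
    using support_null[of 0] by (simp add: low_gain_def)
  have mono: "low_gain c \<subseteq> low_gain d" if "c \<le> d" for c d
    using that by (auto simp: low_gain_def)
  have pos: "0 < measure M E" if "E \<in> sets M" "E \<notin> null_sets M" for E
    using that by (auto simp: null_sets_def emeasure_eq_measure less_le)
  show ?thesis
  proof (cases "norm0 \<Omega> ubar = \<tau>")
    case False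
    have "high_gain r 0 \<in> null_sets M" for r
    proof (rule ccontr)
      assume "high_gain r 0 \<notin> null_sets M"
      then have p: "0 < measure M (high_gain r 0)" using gain_sets pos by blast
      \<comment> \<open>A piece of this size fits into the slack of the constraint, so it is added
        to the support with nothing removed: an exchange with \<open>B\<close> empty and
        \<open>c = 0\<close>.\<close>
      define m where "m = min (measure M (high_gain r 0)) (\<tau> - norm0 \<Omega> ubar)"
      have m: "0 < m" "m \<le> measure M (high_gain r 0)" "norm0 \<Omega> ubar + m \<le> \<tau>"
        using p False ubar(2) by (auto simp: m_def)
      obtain A where A: "A \<subseteq> high_gain r 0" "A \<in> sets M" "measure M A = m"
        using subset_of_measure[OF gain_sets(2) less_imp_le[OF m(1)] m(2)] by blast
      have "A \<in> null_sets M"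
        by (rule exchange[OF A(1,2), of "{}"]) (use A(3) m in auto)
      then show False using A(3) m(1) by (simp add: measure_eq_0_null_sets)
    qed
    then show ?thesis using low0 by (intro exI[of _ 0]) simp
  next
    case True
    \<comment> \<open>Pieces of equal measure leave the support constraint satisfied and make both
      sides of the last condition of \<open>exchange\<close> equal.\<close>
    have dichotomy: "high_gain r c \<in> null_sets M" if "low_gain c \<notin> null_sets M" for r c
    proof (rule ccontr)
      assume "high_gain r c \<notin> null_sets M"
      then have p: "0 < measure M (high_gain r c)" "0 < measure M (low_gain c)"
        using gain_sets pos that by blast+
      define m where "m = min (measure M (high_gain r c)) (measure M (low_gain c))"
      have m: "0 < m" "m \<le> measure M (high_gain r c)" "m \<le> measure M (low_gain c)"
        using p by (auto simp: m_def)
      obtain A where A: "A \<subseteq> high_gain r c" "A \<in> sets M" "measure M A = m"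
        using subset_of_measure[OF gain_sets(2) less_imp_le[OF m(1)] m(2)] by blast
      obtain B where B: "B \<subseteq> low_gain c" "B \<in> sets M" "measure M B = m"
        using subset_of_measure[OF gain_sets(1) less_imp_le[OF m(1)] m(3)] by blast
      have "A \<in> null_sets M"
        by (rule exchange[OF A(1,2) B(1,2)]) (simp_all add: A(3) B(3) ubar(2))
      then show False using A(3) m(1) by (simp add: measure_eq_0_null_sets)
    qed
    define C where "C = {c. 0 \<le> c \<and> low_gain c \<in> null_sets M}"
    have C0: "0 \<in> C" using low0 by (simp add: C_def)
    \<comment> \<open>This bounds \<open>C\<close>. Otherwise the support, being the union of all
      \<open>low_gain (real n)\<close>, would be null, although its measure is
      \<open>\<tau> > 0\<close>.\<close>
    have "\<exists>n. low_gain (real n) \<notin> null_sets M"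
    proof (rule ccontr)
      assume "\<nexists>n. low_gain (real n) \<notin> null_sets M"
      then have "(\<Union>n. low_gain (real n)) \<in> null_sets M" by (intro null_sets_UN) blast
      moreover have "(\<Union>n. low_gain (real n)) = {x \<in> \<Omega>. ubar x \<noteq> 0}"
        using reals_Archimedean2 by (auto simp: low_gain_def)
      ultimately have "norm0 \<Omega> ubar = 0" by (simp add: norm0_eq measure_eq_0_null_sets)
      then show False using True tau by simp
    qed
    then obtain n where n: "low_gain (real n) \<notin> null_sets M" by blast
    have "c \<le> real n" if "c \<in> C" for c
    proof (rule ccontr)
      assume "\<not> c \<le> real n"
      then have "low_gain (real n) \<subseteq> low_gain c" by (intro mono) simp
      moreover have "low_gain c \<in> null_sets M" using that by (simp add: C_def)
      ultimately show False using n gain_sets(1) null_sets_subset by blast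
    qed
    then have bdd: "bdd_above C" by (intro bdd_aboveI)
    define s where "s = Sup C"
    have s0: "0 \<le> s" unfolding s_def by (rule cSup_upper[OF C0 bdd])
    \<comment> \<open>The supremum belongs to \<open>C\<close>: the strict inequality in
      \<open>low_gain s\<close> already holds for some threshold below \<open>s\<close>, and
      countably many thresholds suffice.\<close>
    have "low_gain (s - inverse (real (Suc k))) \<in> null_sets M" for k
    proof -
      have "s - inverse (real (Suc k)) < Sup C" by (simp add: s_def)
      then obtain c where c: "c \<in> C" "s - inverse (real (Suc k)) < c"
        using less_cSup_iff[OF _ bdd] C0 by blast
      have "low_gain c \<in> null_sets M" using c(1) by (simp add: C_def)
      then show ?thesis
        by (rule null_sets_subset[OF _ gain_sets(1) mono]) (use c in simp)
    qed
    then have "(\<Union>k. low_gain (s - inverse (real (Suc k)))) \<in> null_sets M" by (rule null_sets_UN)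
    moreover have "low_gain s \<subseteq> (\<Union>k. low_gain (s - inverse (real (Suc k))))"
    proof
      fix x assume x: "x \<in> low_gain s"
      then have "0 < s - (h x 0 - h x (ubar x))" by (simp add: low_gain_def)
      then obtain k where "inverse (real (Suc k)) < s - (h x 0 - h x (ubar x))"
        using reals_Archimedean by blast
      then have "x \<in> low_gain (s - inverse (real (Suc k)))" using x by (simp add: low_gain_def)
      then show "x \<in> (\<Union>k. low_gain (s - inverse (real (Suc k))))" by blast
    qed
    ultimately have low: "low_gain s \<in> null_sets M" by (rule null_sets_subset[OF _ gain_sets(1)])
    have "high_gain r s \<in> null_sets M" for r
    proof -
      \<comment> \<open>Thresholds above \<open>s\<close> lie outside \<open>C\<close>, so the
        dichotomy applies to them; they then decrease to \<open>s\<close>.\<close>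
      have "high_gain r (s + inverse (real (Suc k))) \<in> null_sets M" for k
      proof (rule dichotomy, rule notI)
        assume null: "low_gain (s + inverse (real (Suc k))) \<in> null_sets M"
        have "0 < inverse (real (Suc k))" by simp
        with null s0 have "s + inverse (real (Suc k)) \<in> C" by (simp add: C_def del: of_nat_Suc)
        then have "s + inverse (real (Suc k)) \<le> s" unfolding s_def by (rule cSup_upper[OF _ bdd])
        then show False using \<open>0 < inverse (real (Suc k))\<close> by linarith
      qed
      then have "(\<Union>k. high_gain r (s + inverse (real (Suc k)))) \<in> null_sets M" by (rule null_sets_UN)
      moreover have "high_gain r s \<subseteq> (\<Union>k. high_gain r (s + inverse (real (Suc k))))"
      proof
        fix x assume x: "x \<in> high_gain r s"
        then have "0 < h x 0 - h x r - s" by (simp add: high_gain_def)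
        then obtain k where "inverse (real (Suc k)) < h x 0 - h x r - s"
          using reals_Archimedean by blast
        then have "x \<in> high_gain r (s + inverse (real (Suc k)))" using x by (simp add: high_gain_def)
        then show "x \<in> (\<Union>k. high_gain r (s + inverse (real (Suc k))))" by blast
      qed
      ultimately show ?thesis by (rule null_sets_subset[OF _ gain_sets(2)])
    qed
    then show ?thesis using low s0 True by (intro exI[of _ s]) simp
  qed
qed

text \<open>On the support, nonzero values \<open>u\<close> are compared through
  \<open>support_null\<close> and \<open>u = 0\<close> through \<open>low_gain\<close>; off the
  support, \<open>high_gain\<close> gives the bound. The multiplier is
  \<open>s = - c\<close>.\<close>

theorem pointwise_minimality:
  "\<exists>s\<le>0. s * (norm0 \<Omega> ubar - \<tau>) = 0 \<and>
    (AE x in M. \<forall>u. h x (ubar x) + (- s) * abs0 (ubar x) \<le> h x u + (- s) * abs0 u) \<and>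
    (AE x in M. ubar x \<noteq> 0 \<longrightarrow> (\<forall>u. h x (ubar x) \<le> h x u)) \<and>
    (AE x in M. abs0 (ubar x) * ((INF u. h x u) - h x 0 - s) \<le> 0)"
proof -
  obtain c where c: "0 \<le> c" "c * (norm0 \<Omega> ubar - \<tau>) = 0" "low_gain c \<in> null_sets M"
      "\<And>r. high_gain r c \<in> null_sets M"
    using multiplier_exists by blast
  have ae_space: "AE x in M. x \<in> \<Omega>" by (rule AE_I2) simp
  have "AE x in M. \<forall>r\<in>\<rat>. x \<notin> {x \<in> \<Omega>. ubar x \<noteq> 0 \<and> h x r < h x (ubar x)}"
    unfolding AE_ball_countable[OF countable_rat] using support_null AE_not_in by blast
  with ae_space cont have min: "AE x in M. ubar x \<noteq> 0 \<longrightarrow> (\<forall>u. h x (ubar x) \<le> h x u)"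
  proof eventually_elim
    case (elim x)
    show ?case
    proof (intro impI allI)
      fix u assume "ubar x \<noteq> 0"
      then have "h x (ubar x) \<le> h x r" if "r \<in> \<rat>" for r using elim(1,3) that by force
      then show "h x (ubar x) \<le> h x u" by (rule continuous_le_of_rationals[OF elim(2)])
    qed
  qed
  have "AE x in M. x \<notin> low_gain c" using c(3) by (rule AE_not_in)
  with ae_space have low: "AE x in M. ubar x \<noteq> 0 \<longrightarrow> h x (ubar x) + c \<le> h x 0"
    by eventually_elim (auto simp: low_gain_def)
  have "AE x in M. \<forall>r\<in>\<rat>. x \<notin> high_gain r c"
    unfolding AE_ball_countable[OF countable_rat] using c(4) AE_not_in by blast
  with ae_space cont have high: "AE x in M. ubar x = 0 \<longrightarrow> (\<forall>u. h x 0 - c \<le> h x u)"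
  proof eventually_elim
    case (elim x)
    show ?case
    proof (intro impI allI)
      fix u assume "ubar x = 0"
      then have "h x 0 - c \<le> h x r" if "r \<in> \<rat>" for r
        using elim(1,3) that by (force simp: high_gain_def)
      then show "h x 0 - c \<le> h x u" by (rule continuous_le_of_rationals[OF elim(2)])
    qed
  qed
  have one: "AE x in M. \<forall>u. h x (ubar x) + c * abs0 (ubar x) \<le> h x u + c * abs0 u"
    using min low high
  proof eventually_elim
    case (elim x)
    show ?case
    proof
      fix u
      show "h x (ubar x) + c * abs0 (ubar x) \<le> h x u + c * abs0 u"
      proof (cases "ubar x = 0")
        case True
        then have "h x 0 - c \<le> h x u" using elim(3) by blast
        then show ?thesis using True by (cases "u = 0") (simp_all add: abs0_def)
      next
        case False
        then have "h x (ubar x) \<le> h x u" "h x (ubar x) + c \<le> h x 0" using elim by blast+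
        then show ?thesis using False by (cases "u = 0") (simp_all add: abs0_def)
      qed
    qed
  qed
  have inf: "AE x in M. abs0 (ubar x) * ((INF u. h x u) - h x 0 + c) \<le> 0"
    using min low
  proof eventually_elim
    case (elim x)
    show ?case
    proof (cases "ubar x = 0")
      case False
      then have le: "\<And>u. h x (ubar x) \<le> h x u" using elim by blast
      \<comment> \<open>On the support the infimum is attained at \<open>ubar x\<close>, so the
        claim becomes the bound from \<open>low_gain\<close>; off the support the factor
        \<open>abs0 (ubar x)\<close> vanishes.\<close>
      have "(INF u. h x u) = h x (ubar x)"
        by (rule cInf_eq_minimum) (use le in auto)
      then show ?thesis using elim(2) False by (simp add: abs0_def)
    qed (simp add: abs0_def)
  qed
  show ?thesis
    using c(1,2) one min inf by (intro exI[of _ "- c"]) simp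
qed

end

section \<open>The Hamiltonian\<close>

lemma Lp_2_square_integrable:
  assumes "v \<in> Lp 2 \<Omega>"
  shows "integrable (lebesgue_on \<Omega>) (\<lambda>x. (v x)\<^sup>2)"
proof -
  have "\<bar>t\<bar> powr 2 = t\<^sup>2" for t :: real
    by (cases "t = 0") (simp_all add: powr_numeral)
  then show ?thesis using LpD(2)[OF assms] by simp
qed

text \<open>The bound \<open>M\<close> on the state fixes the constants of the growth conditions.
  Then \<open>L\<close> is dominated by an integrable function plus a multiple of the square of
  \<open>v\<close>, and \<open>\<phi> * f\<close> by squares of \<open>\<phi>\<close>,
  \<open>c\<close> and \<open>v\<close>.\<close>

lemma hamiltonian_integrable:
  assumes \<Omega>: "\<Omega> \<in> sets lebesgue" and nonlin: "nonlinearities \<Omega> f L"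
    and y: "y \<in> borel_measurable (lebesgue_on \<Omega>)" "0 < M" "AE x in lebesgue_on \<Omega>. \<bar>y x\<bar> \<le> M"
    and \<phi>: "\<phi> \<in> Lp 2 \<Omega>" and v: "v \<in> Lp 2 \<Omega>"
  shows "integrable (lebesgue_on \<Omega>) (\<lambda>x. hamiltonian L f x (y x) (v x) (\<phi> x))"
proof -
  have car: "caratheodory \<Omega> f" "caratheodory \<Omega> L" and gr: "growth_conditions \<Omega> f L"
    using nonlin unfolding nonlinearities_def by blast+
  note [measurable] = LpD(1)[OF \<phi>] LpD(1)[OF v]
    caratheodory_measurable[OF \<Omega> car(1) y(1) LpD(1)[OF v]]
    caratheodory_measurable[OF \<Omega> car(2) y(1) LpD(1)[OF v]]
  obtain a b c where a: "a \<in> Lp 1 \<Omega>" and c: "c \<in> Lp 2 \<Omega>" and b: "0 \<le> b"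
    and bound: "AE x in lebesgue_on \<Omega>. \<forall>u y. \<bar>y\<bar> \<le> M \<longrightarrow>
      \<bar>L x y u\<bar> + \<bar>deriv_y L x y u\<bar> \<le> a x + b * \<bar>u\<bar>\<^sup>2 \<and>
      \<bar>f x y u\<bar> + \<bar>deriv_y f x y u\<bar> \<le> c x + b * \<bar>u\<bar>"
    using gr y(2) unfolding growth_conditions_def by blast
  have sq: "integrable (lebesgue_on \<Omega>) (\<lambda>x. (v x)\<^sup>2)" "integrable (lebesgue_on \<Omega>) (\<lambda>x. (\<phi> x)\<^sup>2)"
      "integrable (lebesgue_on \<Omega>) (\<lambda>x. (c x)\<^sup>2)"
    using v \<phi> c by (simp_all add: Lp_2_square_integrable)
  have "integrable (lebesgue_on \<Omega>) (\<lambda>x. \<bar>a x\<bar>)" using LpD(2)[OF a] by simp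
  with sq have "integrable (lebesgue_on \<Omega>)
      (\<lambda>x. \<bar>a x\<bar> + b * (v x)\<^sup>2 + ((\<phi> x)\<^sup>2 + (c x)\<^sup>2) + b * ((\<phi> x)\<^sup>2 + (v x)\<^sup>2))"
    by simp
  then show ?thesis
  proof (rule Bochner_Integration.integrable_bound)
    show "(\<lambda>x. hamiltonian L f x (y x) (v x) (\<phi> x)) \<in> borel_measurable (lebesgue_on \<Omega>)"
      unfolding hamiltonian_def by measurable
    show "AE x in lebesgue_on \<Omega>. norm (hamiltonian L f x (y x) (v x) (\<phi> x))
      \<le> norm (\<bar>a x\<bar> + b * (v x)\<^sup>2 + ((\<phi> x)\<^sup>2 + (c x)\<^sup>2) + b * ((\<phi> x)\<^sup>2 + (v x)\<^sup>2))"
      using bound y(3)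
    proof eventually_elim
      case (elim x)
      have prod: "\<bar>s\<bar> * \<bar>t\<bar> \<le> s\<^sup>2 + t\<^sup>2" for s t :: real
      proof -
        have "2 * (\<bar>s\<bar> * \<bar>t\<bar>) \<le> s\<^sup>2 + t\<^sup>2"
          using sum_squares_bound[of "\<bar>s\<bar>" "\<bar>t\<bar>"] by (simp add: mult.assoc)
        moreover have "0 \<le> \<bar>s\<bar> * \<bar>t\<bar>" by simp
        ultimately show ?thesis by linarith
      qed
      have "\<bar>L x (y x) (v x)\<bar> + \<bar>deriv_y L x (y x) (v x)\<bar> \<le> a x + b * \<bar>v x\<bar>\<^sup>2"
        and "\<bar>f x (y x) (v x)\<bar> + \<bar>deriv_y f x (y x) (v x)\<bar> \<le> c x + b * \<bar>v x\<bar>"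
        using elim by blast+
      then have L: "\<bar>L x (y x) (v x)\<bar> \<le> \<bar>a x\<bar> + b * (v x)\<^sup>2"
        and F: "\<bar>f x (y x) (v x)\<bar> \<le> \<bar>c x\<bar> + b * \<bar>v x\<bar>" by simp_all
      have "\<bar>\<phi> x * f x (y x) (v x)\<bar> \<le> \<bar>\<phi> x\<bar> * (\<bar>c x\<bar> + b * \<bar>v x\<bar>)"
        unfolding abs_mult by (rule mult_left_mono[OF F]) simp
      also have "\<dots> = \<bar>\<phi> x\<bar> * \<bar>c x\<bar> + b * (\<bar>\<phi> x\<bar> * \<bar>v x\<bar>)" by (simp add: distrib_left)
      also have "\<dots> \<le> ((\<phi> x)\<^sup>2 + (c x)\<^sup>2) + b * ((\<phi> x)\<^sup>2 + (v x)\<^sup>2)"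
        by (intro add_mono mult_left_mono prod b)
      finally show ?case unfolding hamiltonian_def using L by simp
    qed
  qed
qed

lemma hamiltonian_continuous:
  assumes "nonlinearities \<Omega> f L"
  shows "AE x in lebesgue_on \<Omega>. continuous_on UNIV (\<lambda>u. hamiltonian L f x (y x) u (\<phi> x))"
proof -
  have "AE x in lebesgue_on \<Omega>. continuous_on UNIV (\<lambda>(y, u). f x y u)"
    and "AE x in lebesgue_on \<Omega>. continuous_on UNIV (\<lambda>(y, u). L x y u)"
    using assms unfolding nonlinearities_def caratheodory_def by blast+
  then show ?thesis
  proof eventually_elim
    case (elim x)
    have pair: "continuous_on UNIV (\<lambda>u::real. (y x, u))" by (intro continuous_intros)
    have "continuous_on UNIV (\<lambda>u. f x (y x) u)" "continuous_on UNIV (\<lambda>u. L x (y x) u)"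
      using continuous_on_compose2[OF elim(1) pair] continuous_on_compose2[OF elim(2) pair] by simp_all
    then show ?case unfolding hamiltonian_def by (intro continuous_intros)
  qed
qed

theorem theorem4p5:
  fixes \<Omega> :: "(real^'n) set"
    and a :: "real^'n \<Rightarrow> real^'n^'n"
    and f L :: "real^'n \<Rightarrow> real \<Rightarrow> real \<Rightarrow> real"
    and \<tau> p q :: real
    and ubar ybar phibar :: "real^'n \<Rightarrow> real"
  assumes dim: "CARD('n) \<in> {2, 3}"
    and domain: "open \<Omega>" "connected \<Omega>" "bounded \<Omega>" "lipschitz_boundary \<Omega>"
    and tau: "0 < \<tau>" "\<tau> < measure lebesgue \<Omega>"
    and coeffs: "elliptic_coefficients \<Omega> a"
    and nonlin: "nonlinearities \<Omega> f L"
    and exponents: "real CARD('n) < p" "1 / p + 1 / q = 1" "embeds_in_L2 q \<Omega>"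
    and local_sol: "local_solution p q \<Omega> \<tau> a f L ubar"
    and state: "weak_state p q \<Omega> a f ubar ybar"
      "AE x in lebesgue_on \<Omega>. ybar x = state p q \<Omega> a f ubar x"
    and adjoint: "weak_adjoint p q \<Omega> a f L ubar ybar phibar"
    and max_principle: "\<forall>v \<in> Lp 2 \<Omega>. norm0 \<Omega> v \<le> \<tau> \<longrightarrow>
      (\<integral>x. hamiltonian L f x (ybar x) (ubar x) (phibar x) \<partial>(lebesgue_on \<Omega>))
        \<le> (\<integral>x. hamiltonian L f x (ybar x) (v x) (phibar x) \<partial>(lebesgue_on \<Omega>))"
  shows "\<exists>s\<le>0. s * (norm0 \<Omega> ubar - \<tau>) = 0 \<and>
    (AE x in lebesgue_on \<Omega>. \<forall>u.
       hamiltonian L f x (ybar x) (ubar x) (phibar x) + (- s) * abs0 (ubar x)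
         \<le> hamiltonian L f x (ybar x) u (phibar x) + (- s) * abs0 u) \<and>
    (AE x in lebesgue_on \<Omega>. ubar x \<noteq> 0 \<longrightarrow> (\<forall>u.
       hamiltonian L f x (ybar x) (ubar x) (phibar x)
         \<le> hamiltonian L f x (ybar x) u (phibar x))) \<and>
    (AE x in lebesgue_on \<Omega>.
       abs0 (ubar x) * ((INF u. hamiltonian L f x (ybar x) u (phibar x))
         - hamiltonian L f x (ybar x) 0 (phibar x) - s) \<le> 0)"
proof -
  have sets: "\<Omega> \<in> sets lebesgue" using domain(1) by (rule lebesgue_openin[of UNIV, simplified])
  have y: "ybar \<in> W1p0 p \<Omega>" using state(1) by (simp add: weak_state_def)
  then have ym: "ybar \<in> borel_measurable (lebesgue_on \<Omega>)"
    unfolding W1p0_def W1p_def by (auto dest: LpD)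
  \<comment> \<open>Here \<open>p > d\<close> enters: a bounded state makes the growth conditions
    applicable with one \<open>M\<close>.\<close>
  obtain M where M: "0 < M" "AE x in lebesgue_on \<Omega>. \<bar>ybar x\<bar> \<le> M"
    by (rule W1p0_bounded[OF domain(1,3) exponents(1) y])
  \<comment> \<open>Square integrability of the adjoint state, from the embedding, controls its
    product with \<open>f\<close>, which grows linearly in the control.\<close>
  have \<phi>: "phibar \<in> Lp 2 \<Omega>"
    using adjoint exponents(3) unfolding weak_adjoint_def embeds_in_L2_def by blast
  \<comment> \<open>The integrated minimum condition makes \<open>ubar\<close> a global minimizer
    for the Hamiltonian with state and adjoint frozen, which is the situation of the exchange
    argument.\<close>
  interpret sparse_minimizer \<Omega> "\<lambda>x u. hamiltonian L f x (ybar x) u (phibar x)" \<tau> ubar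
  proof
    show "AE x in lebesgue_on \<Omega>. continuous_on UNIV (\<lambda>u. hamiltonian L f x (ybar x) u (phibar x))"
      by (rule hamiltonian_continuous[OF nonlin])
    show "ubar \<in> Lp 2 \<Omega>" "norm0 \<Omega> ubar \<le> \<tau>" using local_sol by (simp_all add: local_solution_def)
    show "integrable (lebesgue_on \<Omega>) (\<lambda>x. hamiltonian L f x (ybar x) (v x) (phibar x))"
      if "v \<in> Lp 2 \<Omega>" for v
      by (rule hamiltonian_integrable[OF sets nonlin ym M \<phi> that])
  qed (use sets domain(3) tau(1) max_principle in blast)+
  show ?thesis by (rule pointwise_minimality)
qed

end
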